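(* Let $(\mathcal M,g)$ be a Riemannian manifold without boundary of class $C^2$ modelled over a Hilbert space $\mathcal H$, and let $G$ be a group of $C^1$-isometries of $(\mathcal M,g)$. Suppose that $\mathcal E\in C^{1,1}_{\mathrm{loc}}(\mathcal M)$ is invariant under $G$, i.e., $\mathcal E=\mathcal E\circ\Gamma$ for all $\Gamma\in G$, that $\mathcal E$ satisfies the Palais–Smale condition, that $\mathcal E$ is bounded from below on $\mathcal M$, and that every Cauchy sequence $(x_k)$ in $\mathcal M$ with respect to the path metric such that $(\mathcal E(x_k))_k$ is bounded converges to some $x_\infty\in\mathcal M$. Then the gradient flow $$\dot\xi(t)=-\nabla\mathcal E(\xi(t)),\qquad \xi(0)=x,$$ preserves the $G$-symmetry, that is, for every initial point $x\in\mathcal M$ that satisfies $\Gamma x=x$ for all $\Gamma\in G$, the solution $\xi$ satisfies $\Gamma\xi(t)=\xi(t)$ for all $\Gamma\in G$ and $t\in[0,\infty)$. In addition, $\xi$ subconverges (as $t\to\infty$) to a $G$-symmetric critical point $x_\infty$ of $\mathcal E$, i.e., with $\Gamma x_\infty=x_\infty$ for all $\Gamma\in G$. In particular, in any connected component $\mathcal K$ of $\mathcal M$ that contains a $G$-symmetric point $x$ there is a $G$-symmetric $\mathcal E$-critical point.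
   Context: The Riemannian metric $g$ is given fibrewise by inner products $g_x$ on $T_x\mathcal M$ (a strong metric of class $C^1$: $\|\cdot\|_{g_x}=\sqrt{g_x(\cdot,\cdot)}$ is equivalent to the norm of the model space). The gradient is defined by $D\mathcal E_x(h)=g_x(\nabla\mathcal E(x),h)$ for $h\in T_x\mathcal M$; $\mathcal E\in C^{1,1}_{\mathrm{loc}}$ means $C^1$ with locally Lipschitz differential. A point $x$ is $\mathcal E$-critical if $D\mathcal E_x=0$. Under the stated hypotheses the gradient flow has a unique solution $\xi\in C^1([0,\infty),\mathcal M)$ for every initial point. A $C^1$-isometry is a $C^1$-diffeomorphism $\Gamma$ of $\mathcal M$ with $g_{\Gamma x}(D\Gamma_xh,D\Gamma_xk)=g_x(h,k)$. A point $x$ is $G$-symmetric if $\Gamma x=x$ for all $\Gamma\in G$. Path metric: for $x,y$ in the same connected component, $\mathrm{dist}_{\mathcal M}(x,y)=\inf_c\int_0^1\|\dot c(t)\|_{g_{c(t)}}\,dt$ over all $c\in C^1([0,1],\mathcal M)$ with $c(0)=x$, $c(1)=y$. Cauchy sequences in $\mathcal M$ are understood to lie, up to finitely many members, in one connected component. A Palais–Smale sequence for $\mathcal E$ is $(x_k)\subset\mathcal M$ with $\sup_k\mathcal E(x_k)<\infty$ and $\|D\mathcal E_{x_k}\|_{(T_{x_k}\mathcal M)^*}\to0$. The Palais–Smale condition: every Palais–Smale sequence has a subsequence converging in $\mathcal M$. "$\xi$ subconverges to $x_\infty$" means $\xi(t_k)\to x_\infty$ for some sequence $t_k\to\infty$.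 *)

theory Defs
  imports "HOL-Analysis.Analysis" "HOL-Algebra.Bij"
begin

section \<open>Regularity classes on open subsets of normed spaces\<close>

definition C1_on :: "'a::real_normed_vector set \<Rightarrow> ('a \<Rightarrow> 'b::real_normed_vector) \<Rightarrow> bool" where
  "C1_on S f \<longleftrightarrow>
    (\<exists>f' :: 'a \<Rightarrow> 'a \<Rightarrow>\<^sub>L 'b.
      (\<forall>x\<in>S. (f has_derivative blinfun_apply (f' x)) (at x)) \<and> continuous_on S f')"

definition C2_on :: "'a::real_normed_vector set \<Rightarrow> ('a \<Rightarrow> 'b::real_normed_vector) \<Rightarrow> bool" where
  "C2_on S f \<longleftrightarrow>
    (\<exists>f' :: 'a \<Rightarrow> 'a \<Rightarrow>\<^sub>L 'b.
      (\<forall>x\<in>S. (f has_derivative blinfun_apply (f' x)) (at x)) \<and> C1_on S f')"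

definition locally_lipschitz_on ::
    "'a::metric_space set \<Rightarrow> ('a \<Rightarrow> 'b::metric_space) \<Rightarrow> bool" where
  "locally_lipschitz_on S f \<longleftrightarrow> (\<forall>x\<in>S. \<exists>r>0. \<exists>L. L-lipschitz_on (ball x r \<inter> S) f)"

text \<open>Continuity of the derivative is implied by its local Lipschitz property.\<close>

definition C11_loc_on :: "'a::real_normed_vector set \<Rightarrow> ('a \<Rightarrow> 'b::real_normed_vector) \<Rightarrow> bool" where
  "C11_loc_on S f \<longleftrightarrow>
    (\<exists>f' :: 'a \<Rightarrow> 'a \<Rightarrow>\<^sub>L 'b.
      (\<forall>x\<in>S. (f has_derivative blinfun_apply (f' x)) (at x)) \<and> locally_lipschitz_on S f')"


section \<open>Manifolds of class C2 without boundary modelled over a Hilbert space\<close>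

text \<open>A chart is a pair of its domain and its coordinate map; the values of the coordinate map
  outside the domain are irrelevant.\<close>

type_synonym ('a, 'h) chart = "'a set \<times> ('a \<Rightarrow> 'h)"

abbreviation chart_dom :: "('a, 'h) chart \<Rightarrow> 'a set" where
  "chart_dom \<equiv> fst"

abbreviation chart_map :: "('a, 'h) chart \<Rightarrow> 'a \<Rightarrow> 'h" where
  "chart_map \<equiv> snd"

definition chart_inv :: "('a, 'h) chart \<Rightarrow> 'h \<Rightarrow> 'a" where
  "chart_inv c = inv_into (chart_dom c) (chart_map c)"

definition transition :: "('a, 'h) chart \<Rightarrow> ('a, 'h) chart \<Rightarrow> 'h \<Rightarrow> 'h" where
  "transition c d = chart_map d \<circ> chart_inv c"

text \<open>The absence of a boundary is expressed by the requirement that the chart images are open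
  in the model space.\<close>

definition hilbert_manifold_C2 ::
    "'a topology \<Rightarrow> ('a, 'h::{real_inner, complete_space}) chart set \<Rightarrow> bool" where
  "hilbert_manifold_C2 M A \<longleftrightarrow>
    Hausdorff_space M \<and>
    topspace M = (\<Union>c\<in>A. chart_dom c) \<and>
    (\<forall>c\<in>A. openin M (chart_dom c) \<and> open (chart_map c ` chart_dom c) \<and>
       homeomorphic_map (subtopology M (chart_dom c)) (top_of_set (chart_map c ` chart_dom c))
         (chart_map c)) \<and>
    (\<forall>c\<in>A. \<forall>d\<in>A. C2_on (chart_map c ` (chart_dom c \<inter> chart_dom d)) (transition c d))"


section \<open>Tangent spaces and derivatives\<close>

text \<open>A tangent vector at \<open>p\<close> is usually an equivalence class of pairs \<open>(c, h)\<close> of a chart around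
  \<open>p\<close> and a vector of the model space, where \<open>(c, h)\<close> and \<open>(d, k)\<close> are identified if the derivative
  of the coordinate change maps \<open>h\<close> to \<open>k\<close>. Such a class is the graph of a function assigning to
  every chart around \<open>p\<close> the representative in that chart. It is encoded by this function, set to 0
  for all other arguments, so that the vector space operations are the pointwise ones.\<close>

type_synonym ('a, 'h) tangent = "('a, 'h) chart \<Rightarrow> 'h"

definition tangent_space ::
    "('a, 'h::real_normed_vector) chart set \<Rightarrow> 'a \<Rightarrow> ('a, 'h) tangent set" where
  "tangent_space A p =
    {v. (\<forall>c. \<not> (c \<in> A \<and> p \<in> chart_dom c) \<longrightarrow> v c = 0) \<and>
        (\<forall>c\<in>A. \<forall>d\<in>A. p \<in> chart_dom c \<inter> chart_dom d \<longrightarrow>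
           v d = frechet_derivative (transition c d) (at (chart_map c p)) (v c))}"

text \<open>The derivatives below do not depend on the chart selected here.\<close>

definition chart_at :: "('a, 'h) chart set \<Rightarrow> 'a \<Rightarrow> ('a, 'h) chart" where
  "chart_at A p = (SOME c. c \<in> A \<and> p \<in> chart_dom c)"

definition differential ::
    "('a, 'h::real_normed_vector) chart set \<Rightarrow> ('a \<Rightarrow> real) \<Rightarrow> 'a \<Rightarrow> ('a, 'h) tangent \<Rightarrow> real" where
  "differential A E p v =
    (let c = chart_at A p
     in frechet_derivative (E \<circ> chart_inv c) (at (chart_map c p)) (v c))"

definition tangent_map ::
    "('a, 'h::real_normed_vector) chart set \<Rightarrow> ('a \<Rightarrow> 'a) \<Rightarrow> 'a \<Rightarrow>
      ('a, 'h) tangent \<Rightarrow> ('a, 'h) tangent" where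
  "tangent_map A f p v =
    (\<lambda>d. if d \<in> A \<and> f p \<in> chart_dom d
         then (let c = chart_at A p
               in frechet_derivative (chart_map d \<circ> f \<circ> chart_inv c) (at (chart_map c p)) (v c))
         else 0)"

text \<open>At an endpoint of the interval \<open>I\<close> the velocity is the one-sided derivative.\<close>

definition velocity ::
    "('a, 'h::real_normed_vector) chart set \<Rightarrow> real set \<Rightarrow> (real \<Rightarrow> 'a) \<Rightarrow> real \<Rightarrow>
      ('a, 'h) tangent" where
  "velocity A I \<gamma> t =
    (\<lambda>d. if d \<in> A \<and> \<gamma> t \<in> chart_dom d
         then vector_derivative (chart_map d \<circ> \<gamma>) (at t within I) else 0)"

definition C1_curve ::
    "'a topology \<Rightarrow> ('a, 'h::real_normed_vector) chart set \<Rightarrow> real set \<Rightarrow> (real \<Rightarrow> 'a) \<Rightarrow> bool" where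
  "C1_curve M A I \<gamma> \<longleftrightarrow>
    continuous_map (top_of_set I) M \<gamma> \<and>
    (\<forall>d\<in>A. \<exists>w. continuous_on {t\<in>I. \<gamma> t \<in> chart_dom d} w \<and>
       (\<forall>t\<in>{t\<in>I. \<gamma> t \<in> chart_dom d}.
          ((chart_map d \<circ> \<gamma>) has_vector_derivative w t) (at t within I)))"

definition C1_map ::
    "'a topology \<Rightarrow> ('a, 'h::real_normed_vector) chart set \<Rightarrow> ('a \<Rightarrow> 'a) \<Rightarrow> bool" where
  "C1_map M A f \<longleftrightarrow>
    continuous_map M M f \<and>
    (\<forall>c\<in>A. \<forall>d\<in>A. C1_on (chart_map c ` {p \<in> chart_dom c. f p \<in> chart_dom d})
       (chart_map d \<circ> f \<circ> chart_inv c))"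

definition C1_diffeomorphism ::
    "'a topology \<Rightarrow> ('a, 'h::real_normed_vector) chart set \<Rightarrow> ('a \<Rightarrow> 'a) \<Rightarrow> bool" where
  "C1_diffeomorphism M A f \<longleftrightarrow>
    bij_betw f (topspace M) (topspace M) \<and> C1_map M A f \<and> C1_map M A (inv_into (topspace M) f)"

definition C11_loc_function ::
    "('a, 'h::real_normed_vector) chart set \<Rightarrow> ('a \<Rightarrow> real) \<Rightarrow> bool" where
  "C11_loc_function A E \<longleftrightarrow>
    (\<forall>c\<in>A. C11_loc_on (chart_map c ` chart_dom c) (E \<circ> chart_inv c))"

definition critical_point ::
    "'a topology \<Rightarrow> ('a, 'h::real_normed_vector) chart set \<Rightarrow> ('a \<Rightarrow> real) \<Rightarrow> 'a \<Rightarrow> bool" where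
  "critical_point M A E p \<longleftrightarrow>
    p \<in> topspace M \<and> (\<forall>h\<in>tangent_space A p. differential A E p h = 0)"


section \<open>Riemannian metrics\<close>

type_synonym ('a, 'h) metric_tensor = "'a \<Rightarrow> ('a, 'h) tangent \<Rightarrow> ('a, 'h) tangent \<Rightarrow> real"

definition inner_product_on_tangent_space ::
    "('a, 'h::real_normed_vector) chart set \<Rightarrow> 'a \<Rightarrow>
      (('a, 'h) tangent \<Rightarrow> ('a, 'h) tangent \<Rightarrow> real) \<Rightarrow> bool" where
  "inner_product_on_tangent_space A p b \<longleftrightarrow>
    (\<forall>u\<in>tangent_space A p. \<forall>v\<in>tangent_space A p. b u v = b v u) \<and>
    (\<forall>u\<in>tangent_space A p. \<forall>v\<in>tangent_space A p. \<forall>w\<in>tangent_space A p.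
       b (\<lambda>c. u c + v c) w = b u w + b v w) \<and>
    (\<forall>r. \<forall>u\<in>tangent_space A p. \<forall>w\<in>tangent_space A p. b (\<lambda>c. r *\<^sub>R u c) w = r * b u w) \<and>
    (\<forall>u\<in>tangent_space A p. u \<noteq> (\<lambda>_. 0) \<longrightarrow> b u u > 0)"

definition metric_norm :: "('a, 'h) metric_tensor \<Rightarrow> 'a \<Rightarrow> ('a, 'h) tangent \<Rightarrow> real" where
  "metric_norm g p v = sqrt (g p v v)"

text \<open>A strong metric of class C1: the norm on each tangent space is equivalent to the norm of the
  model space under the identification given by a chart, and in each chart the metric is a C1 map
  into the space of bounded bilinear forms with the operator norm.\<close>

definition riemannian_metric_C1 ::
    "'a topology \<Rightarrow> ('a, 'h::{real_inner, complete_space}) chart set \<Rightarrow>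
      ('a, 'h) metric_tensor \<Rightarrow> bool" where
  "riemannian_metric_C1 M A g \<longleftrightarrow>
    (\<forall>p\<in>topspace M. inner_product_on_tangent_space A p (g p)) \<and>
    (\<forall>c\<in>A. \<forall>p\<in>chart_dom c. \<exists>m>0. \<exists>K>0. \<forall>v\<in>tangent_space A p.
       m * norm (v c) \<le> metric_norm g p v \<and> metric_norm g p v \<le> K * norm (v c)) \<and>
    (\<forall>c\<in>A. \<exists>B :: 'h \<Rightarrow> 'h \<Rightarrow>\<^sub>L 'h \<Rightarrow>\<^sub>L real.
       C1_on (chart_map c ` chart_dom c) B \<and>
       (\<forall>p\<in>chart_dom c. \<forall>v\<in>tangent_space A p. \<forall>w\<in>tangent_space A p.
          g p v w = blinfun_apply (blinfun_apply (B (chart_map c p)) (v c)) (w c)))"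

definition riemannian_manifold_C2 ::
    "'a topology \<Rightarrow> ('a, 'h::{real_inner, complete_space}) chart set \<Rightarrow>
      ('a, 'h) metric_tensor \<Rightarrow> bool" where
  "riemannian_manifold_C2 M A g \<longleftrightarrow> hilbert_manifold_C2 M A \<and> riemannian_metric_C1 M A g"

definition C1_isometry ::
    "'a topology \<Rightarrow> ('a, 'h::{real_inner, complete_space}) chart set \<Rightarrow>
      ('a, 'h) metric_tensor \<Rightarrow> ('a \<Rightarrow> 'a) \<Rightarrow> bool" where
  "C1_isometry M A g \<Gamma> \<longleftrightarrow>
    C1_diffeomorphism M A \<Gamma> \<and>
    (\<forall>p\<in>topspace M. \<forall>h\<in>tangent_space A p. \<forall>k\<in>tangent_space A p.
       g (\<Gamma> p) (tangent_map A \<Gamma> p h) (tangent_map A \<Gamma> p k) = g p h k)"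

text \<open>Group elements are maps of \<open>M\<close>; as elements of \<open>Bij\<close> they take the value \<open>undefined\<close>
  outside \<open>M\<close>, which makes the group operations of \<open>BijGroup\<close> those of the maps of \<open>M\<close>.\<close>

definition group_of_C1_isometries ::
    "'a topology \<Rightarrow> ('a, 'h::{real_inner, complete_space}) chart set \<Rightarrow>
      ('a, 'h) metric_tensor \<Rightarrow> ('a \<Rightarrow> 'a) set \<Rightarrow> bool" where
  "group_of_C1_isometries M A g G \<longleftrightarrow>
    subgroup G (BijGroup (topspace M)) \<and> (\<forall>\<Gamma>\<in>G. C1_isometry M A g \<Gamma>)"

definition symmetric_point :: "'a topology \<Rightarrow> ('a \<Rightarrow> 'a) set \<Rightarrow> 'a \<Rightarrow> bool" where
  "symmetric_point M G x \<longleftrightarrow> x \<in> topspace M \<and> (\<forall>\<Gamma>\<in>G. \<Gamma> x = x)"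


section \<open>Path metric\<close>

definition curve_length ::
    "('a, 'h::real_normed_vector) chart set \<Rightarrow> ('a, 'h) metric_tensor \<Rightarrow> (real \<Rightarrow> 'a) \<Rightarrow> real" where
  "curve_length A g \<gamma> = integral {0..1} (\<lambda>t. metric_norm g (\<gamma> t) (velocity A {0..1} \<gamma> t))"

text \<open>Only meaningful for points of the same connected component, where the infimum is taken over
  a nonempty set.\<close>

definition path_dist ::
    "'a topology \<Rightarrow> ('a, 'h::real_normed_vector) chart set \<Rightarrow> ('a, 'h) metric_tensor \<Rightarrow>
      'a \<Rightarrow> 'a \<Rightarrow> real" where
  "path_dist M A g x y =
    Inf {curve_length A g \<gamma> | \<gamma>. C1_curve M A {0..1} \<gamma> \<and> \<gamma> 0 = x \<and> \<gamma> 1 = y}"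

definition path_Cauchy ::
    "'a topology \<Rightarrow> ('a, 'h::real_normed_vector) chart set \<Rightarrow> ('a, 'h) metric_tensor \<Rightarrow>
      (nat \<Rightarrow> 'a) \<Rightarrow> bool" where
  "path_Cauchy M A g x \<longleftrightarrow>
    (\<forall>k. x k \<in> topspace M) \<and>
    (\<exists>K\<in>connected_components_of M. \<exists>N\<^sub>0. (\<forall>k\<ge>N\<^sub>0. x k \<in> K) \<and>
       (\<forall>\<epsilon>>0. \<exists>N\<ge>N\<^sub>0. \<forall>m\<ge>N. \<forall>n\<ge>N. path_dist M A g (x m) (x n) < \<epsilon>))"


section \<open>Palais--Smale condition\<close>

definition differential_norm ::
    "('a, 'h::real_normed_vector) chart set \<Rightarrow> ('a, 'h) metric_tensor \<Rightarrow> ('a \<Rightarrow> real) \<Rightarrow> 'a \<Rightarrow> real" where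
  "differential_norm A g E p =
    (SUP h\<in>{h \<in> tangent_space A p. metric_norm g p h \<le> 1}. \<bar>differential A E p h\<bar>)"

definition Palais_Smale_sequence ::
    "'a topology \<Rightarrow> ('a, 'h::real_normed_vector) chart set \<Rightarrow> ('a, 'h) metric_tensor \<Rightarrow>
      ('a \<Rightarrow> real) \<Rightarrow> (nat \<Rightarrow> 'a) \<Rightarrow> bool" where
  "Palais_Smale_sequence M A g E x \<longleftrightarrow>
    (\<forall>k. x k \<in> topspace M) \<and> bdd_above (range (\<lambda>k. E (x k))) \<and>
    (\<lambda>k. differential_norm A g E (x k)) \<longlonglongrightarrow> 0"

definition Palais_Smale_condition ::
    "'a topology \<Rightarrow> ('a, 'h::real_normed_vector) chart set \<Rightarrow> ('a, 'h) metric_tensor \<Rightarrow>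
      ('a \<Rightarrow> real) \<Rightarrow> bool" where
  "Palais_Smale_condition M A g E \<longleftrightarrow>
    (\<forall>x. Palais_Smale_sequence M A g E x \<longrightarrow>
       (\<exists>r y. strict_mono r \<and> limitin M (x \<circ> r) y sequentially))"


section \<open>Gradient flow\<close>

definition gradient ::
    "('a, 'h::real_normed_vector) chart set \<Rightarrow> ('a, 'h) metric_tensor \<Rightarrow> ('a \<Rightarrow> real) \<Rightarrow> 'a \<Rightarrow>
      ('a, 'h) tangent" where
  "gradient A g E p =
    (THE v. v \<in> tangent_space A p \<and> (\<forall>h\<in>tangent_space A p. differential A E p h = g p v h))"

definition gradient_flow_solution ::
    "'a topology \<Rightarrow> ('a, 'h::real_normed_vector) chart set \<Rightarrow> ('a, 'h) metric_tensor \<Rightarrow>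
      ('a \<Rightarrow> real) \<Rightarrow> 'a \<Rightarrow> (real \<Rightarrow> 'a) \<Rightarrow> bool" where
  "gradient_flow_solution M A g E x \<xi> \<longleftrightarrow>
    C1_curve M A {0..} \<xi> \<and> \<xi> 0 = x \<and>
    (\<forall>t\<ge>0. velocity A {0..} \<xi> t = (\<lambda>c. - gradient A g E (\<xi> t) c))"

definition subconverges :: "'a topology \<Rightarrow> (real \<Rightarrow> 'a) \<Rightarrow> 'a \<Rightarrow> bool" where
  "subconverges M \<xi> y \<longleftrightarrow>
    (\<exists>t :: nat \<Rightarrow> real. (\<forall>k. 0 \<le> t k) \<and> filterlim t at_top sequentially \<and>
       limitin M (\<lambda>k. \<xi> (t k)) y sequentially)"

end

theory Submission
  imports Defs
begin

text \<open>
  In a chart the negative gradient of \<open>E\<close> is a locally Lipschitz vector field, because the metric is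
  of class \<open>C\<^sup>1\<close>, the differential of \<open>E\<close> is locally Lipschitz, and the gradient solves a coercive
  linear equation whose data are these two (\<open>gradient_locally_lipschitz\<close>). Picard-Lindelof therefore
  gives local solutions, and solutions with the same initial point agree
  (\<open>integral_curve_unique\<close>).

  Along a solution \<open>\<xi>\<close> the energy satisfies \<open>(E \<circ> \<xi>)' = - \<parallel>\<nabla>E\<parallel>\<^sup>2\<close>. The speed of \<open>\<xi>\<close> is \<open>\<parallel>\<nabla>E\<parallel>\<close>, which is at
  most \<open>(1 + \<parallel>\<nabla>E\<parallel>\<^sup>2) / 2\<close>; so the length of \<open>\<xi>\<close> between the times \<open>a\<close> and \<open>b\<close> is at most the increase
  of \<open>(t - E (\<xi> t)) / 2\<close> (\<open>path_dist_integral_curve_le\<close>). As \<open>E\<close> is bounded from below, a solution on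
  a finite interval \<open>[0,T)\<close> is Cauchy in the path metric as \<open>t\<close> tends to \<open>T\<close>, hence has a limit point by
  completeness on bounded energy levels. Near that limit the time of existence is bounded
  from below, so the solution extends beyond \<open>T\<close>, and every maximal solution is global
  (\<open>integral_curve_global_existence\<close>).

  An isometry that preserves \<open>E\<close> maps the gradient field to itself (\<open>gradient_equivariant\<close>) and
  therefore solutions to solutions. If it fixes the initial point, uniqueness shows that it fixes
  the whole solution.

  Finally, \<open>E \<circ> \<xi>\<close> is decreasing and bounded below, so by the mean value theorem there are times
  \<open>t\<^sub>k \<rightarrow> \<infinity>\<close> at which \<open>\<parallel>\<nabla>E\<parallel>\<^sup>2\<close> tends to 0. The Palais-Smale condition yields a limit point,
  which is critical since \<open>\<parallel>\<nabla>E\<parallel>\<^sup>2\<close> is continuous, symmetric since the isometries are continuous, and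
  which lies in the connected component of the initial point since components are closed.
\<close>

section \<open>Quadratic minimisation in Hilbert space\<close>

text \<open>The Riesz representation theorem for the inner product \<open>b\<close>: the solution is the minimiser of
  \<open>b v v - 2 * l v\<close>. By the parallelogram law every minimising sequence is Cauchy, and the first
  variation at the minimiser vanishes.\<close>

lemma lax_milgram_symmetric:
  fixes b :: "'h::{real_inner, complete_space} \<Rightarrow> 'h \<Rightarrow> real" and l :: "'h \<Rightarrow> real"
  assumes b: "bounded_bilinear b" and l: "bounded_linear l"
    and sym: "\<And>u v. b u v = b v u"
    and m: "m > 0" and coercive: "\<And>v. m * (norm v)\<^sup>2 \<le> b v v"
  obtains v where "\<And>h. l h = b v h"
proof -
  interpret b: bounded_bilinear b by (rule b)
  interpret l: bounded_linear l by (rule l)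
  define \<phi> where "\<phi> v = b v v - 2 * l v" for v
  define I where "I = Inf (range \<phi>)"
  obtain C where C: "\<And>x. norm (l x) \<le> norm x * C" using l.bounded by blast
  have lower: "- (C\<^sup>2 / m) \<le> \<phi> v" for v
  proof -
    have "l v \<le> norm v * C" using C[of v] by auto
    then have "m * (m * (norm v)\<^sup>2 - 2 * (norm v * C)) \<le> m * \<phi> v"
      unfolding \<phi>_def using coercive[of v] m by (intro mult_left_mono) auto
    moreover have "m * (m * (norm v)\<^sup>2 - 2 * (norm v * C)) = (m * norm v - C)\<^sup>2 - C\<^sup>2"
      by (simp add: power2_eq_square algebra_simps)
    ultimately have "- C\<^sup>2 \<le> m * \<phi> v"
      by (smt (verit) zero_le_power2)
    then show ?thesis using m by (simp add: field_simps)
  qed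
  have bdd: "bdd_below (range \<phi>)" using lower by (intro bdd_belowI[of _ "- (C\<^sup>2 / m)"]) auto
  have I_le: "I \<le> \<phi> v" for v unfolding I_def using bdd by (simp add: cInf_lower)
  have "\<exists>v. \<phi> v < I + 1 / real (Suc n)" for n
    using cInf_lessD[of "range \<phi>" "I + 1 / real (Suc n)"] unfolding I_def by auto
  then obtain v where v: "\<And>n. \<phi> (v n) < I + 1 / real (Suc n)" by metis
  \<comment> \<open>The left-hand side bounds the distance of two almost minimisers, as \<open>\<phi>\<close> is at least \<open>I\<close> at their midpoint.\<close>
  have parallelogram: "b (x - y) (x - y) = 2 * \<phi> x + 2 * \<phi> y - 4 * \<phi> ((1/2) *\<^sub>R (x + y))" for x y
    unfolding \<phi>_def
    by (simp add: b.diff_left b.diff_right b.add_left b.add_right b.scaleR_left b.scaleR_right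
        l.add l.scaleR sym[of y x] algebra_simps)
  have close: "m * (norm (v i - v j))\<^sup>2 \<le> 4 / real (Suc N)" if "i \<ge> N" "j \<ge> N" for i j N
  proof -
    have *: "1 / real (Suc k) \<le> 1 / real (Suc N)" if "k \<ge> N" for k
      using that by (simp add: frac_le)
    have "b (v i - v j) (v i - v j) \<le> 2 * (I + 1 / real (Suc i)) + 2 * (I + 1 / real (Suc j)) - 4 * I"
    proof -
      have "2 * p + 2 * q - 4 * c \<le> 2 * (I + \<delta>) + 2 * (I + \<epsilon>) - 4 * I"
        if "p < I + \<delta>" "q < I + \<epsilon>" "I \<le> c" for p q c \<delta> \<epsilon> :: real using that by (smt (verit))
      then show ?thesis unfolding parallelogram using v I_le by blast
    qed
    also have "\<dots> \<le> 4 / real (Suc N)" using *[OF that(1)] *[OF that(2)] by simp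
    finally show ?thesis using coercive[of "v i - v j"] by linarith
  qed
  have "Cauchy v"
  proof (rule CauchyI)
    fix e :: real assume e: "e > 0"
    obtain N where N: "4 / (m * e\<^sup>2) < real N" using reals_Archimedean2 by blast
    have "norm (v i - v j) < e" if "i \<ge> N" "j \<ge> N" for i j
    proof -
      have "4 < real (Suc N) * (m * e\<^sup>2)" using N m e by (simp add: field_simps) (smt (verit) mult_pos_pos zero_less_power2)
      then have "4 / real (Suc N) < m * e\<^sup>2" by (simp add: field_simps)
      then have "m * (norm (v i - v j))\<^sup>2 < m * e\<^sup>2" using close[OF that] by linarith
      then show ?thesis using m e by (simp add: power2_less_imp_less)
    qed
    then show "\<exists>N. \<forall>i\<ge>N. \<forall>j\<ge>N. norm (v i - v j) < e" by blast
  qed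
  then obtain w where w: "v \<longlonglongrightarrow> w" using Cauchy_convergent_iff convergent_def by blast
  have "(\<lambda>n. \<phi> (v n)) \<longlonglongrightarrow> \<phi> w"
    unfolding \<phi>_def by (intro tendsto_intros b.tendsto l.tendsto w)
  moreover have "(\<lambda>n. I + 1 / real (Suc n)) \<longlonglongrightarrow> I + 0"
    by (intro tendsto_intros LIMSEQ_inverse_real_of_nat[unfolded inverse_eq_divide])
  ultimately have "\<phi> w \<le> I"
    by (intro LIMSEQ_le[of "\<lambda>n. \<phi> (v n)" "\<phi> w" "\<lambda>n. I + 1 / real (Suc n)" I])
      (use v in \<open>auto intro: less_imp_le\<close>)
  then have min: "\<phi> w \<le> \<phi> x" for x using I_le[of x] by linarith
  have "l h = b w h" for h
  proof (rule ccontr)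
    assume neq: "l h \<noteq> b w h"
    define d where "d = b w h - l h"
    define q where "q = b h h"
    have q: "q > 0"
      using coercive[of h] neq m unfolding q_def
      by (smt (verit) b.zero_right l.zero mult_pos_pos zero_less_norm_iff zero_less_power2 norm_eq_zero)
    \<comment> \<open>The step \<open>- d / q\<close> minimises the quadratic polynomial \<open>t \<mapsto> \<phi> (w + t h)\<close>.\<close>
    have "\<phi> (w + (- d / q) *\<^sub>R h) = \<phi> w - d\<^sup>2 / q"
      unfolding \<phi>_def using q
      by (simp add: b.add_left b.add_right b.scaleR_left b.scaleR_right b.diff_left b.diff_right l.add l.scaleR l.diff
          b.minus_left b.minus_right
          sym[of h w] q_def[symmetric]) (simp add: d_def field_simps power2_eq_square)
    moreover have "d\<^sup>2 / q > 0" using q neq by (simp add: d_def)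
    ultimately show False using min[of "w + (- d / q) *\<^sub>R h"] by linarith
  qed
  then show ?thesis using that by blast
qed

text \<open>The next two lemmas make \<^term>\<open>blinfun_inner_left\<close> an isometric isomorphism of a Hilbert space
  onto its dual, which transports statements about Banach spaces to Hilbert spaces.\<close>

lemma riesz_isometry:
  fixes l :: "'h::{real_inner, complete_space} \<Rightarrow>\<^sub>L real"
  obtains x where "blinfun_inner_left x = l"
proof -
  obtain x where "\<And>h. blinfun_apply l h = x \<bullet> h"
    by (rule lax_milgram_symmetric[of inner "blinfun_apply l" 1])
      (auto simp: bounded_bilinear_inner blinfun.bounded_linear_right inner_commute power2_norm_eq_inner)
  then show ?thesis by (intro that blinfun_eqI) (simp add: inner_commute)
qed

lemma norm_blinfun_inner_left: "norm (blinfun_inner_left x) = norm (x :: 'h::real_inner)"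
proof (rule antisym)
  show "norm (blinfun_inner_left x) \<le> norm x"
    by (rule norm_blinfun_bound) (auto simp: Cauchy_Schwarz_ineq2 mult.commute)
  show "norm x \<le> norm (blinfun_inner_left x)"
  proof (cases "x = 0")
    case False
    have "norm x * norm x \<le> norm (blinfun_inner_left x) * norm x"
      using norm_blinfun[of "blinfun_inner_left x" x] by (simp add: dot_square_norm power2_eq_square)
    then show ?thesis using False by simp
  qed simp
qed

section \<open>Ordinary differential equations with Lipschitz right-hand side\<close>

text \<open>The solution is the fixed point of the integral operator, a contraction of the bounded continuous
  functions on the line with values in the ball. The functions live on the whole line so that
  they form a complete metric space as a type; the operator only looks at their values on
  \<open>[0,r]\<close>.\<close>

lemma picard_lindelof_banach:
  fixes F :: "'b::banach \<Rightarrow> 'b"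
  assumes lip: "L-lipschitz_on (cball x0 R) F"
    and bound: "\<And>x. x \<in> cball x0 R \<Longrightarrow> norm (F x) \<le> K"
    and r: "0 < r" "r * K \<le> R" "r * L < 1" and R: "0 \<le> R"
  obtains u where "u 0 = x0" "\<And>t. t \<in> {0..r} \<Longrightarrow> u t \<in> cball x0 R"
    "\<And>t. t \<in> {0..r} \<Longrightarrow> (u has_vector_derivative F (u t)) (at t within {0..r})"
proof -
  define S :: "(real \<Rightarrow>\<^sub>C 'b) set" where "S = PiC UNIV (\<lambda>_. cball x0 R)"
  define \<pi> :: "real \<Rightarrow> real" where "\<pi> t = max 0 (min r t)" for t
  define \<Phi> where "\<Phi> f t = x0 + integral {0..\<pi> t} (\<lambda>s. F (apply_bcontfun f s))" for f t
  have \<pi>: "0 \<le> \<pi> t" "\<pi> t \<le> r" for t using r by (auto simp: \<pi>_def)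
  have K: "K \<ge> 0" using bound[of x0] R norm_ge_zero[of "F x0"] by (meson centre_in_cball order_trans)
  have L: "L \<ge> 0" using lip lipschitz_on_nonneg by blast
  have inball: "apply_bcontfun f s \<in> cball x0 R" if "f \<in> S" for f s
    using that by (auto simp: S_def mem_PiC_iff)
  have cont: "continuous_on T (\<lambda>s. F (apply_bcontfun f s))" if "f \<in> S" for f T
    by (rule continuous_on_compose2[OF lipschitz_on_continuous_on[OF lip]])
      (use inball[OF that] in auto)
  have ball: "\<Phi> f t \<in> cball x0 R" if "f \<in> S" for f t
  proof -
    have "norm (integral {0..\<pi> t} (\<lambda>s. F (apply_bcontfun f s))) \<le> K * (\<pi> t - 0)"
      by (rule integral_bound) (use \<pi> cont[OF that] bound inball[OF that] in auto)
    also have "\<dots> \<le> K * r" using K \<pi>[of t] by (intro mult_left_mono) auto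
    also have "\<dots> \<le> R" using r by (simp add: mult.commute)
    finally show ?thesis by (simp add: \<Phi>_def dist_norm)
  qed
  have \<Phi>_cont: "continuous_on UNIV (\<Phi> f)" if "f \<in> S" for f
  proof -
    have "continuous_on {0..r} (\<lambda>t. integral {0..t} (\<lambda>s. F (apply_bcontfun f s)))"
      by (intro indefinite_integral_continuous_1 integrable_continuous_real cont that)
    moreover have "continuous_on UNIV \<pi>" unfolding \<pi>_def by (intro continuous_intros)
    ultimately show ?thesis unfolding \<Phi>_def
      by (intro continuous_intros continuous_on_compose2[where g = "\<lambda>t. integral {0..t} (\<lambda>s. F (apply_bcontfun f s))" and f = \<pi>])
        (use \<pi> in auto)
  qed
  have \<Phi>_b: "\<Phi> f \<in> bcontfun" if "f \<in> S" for f
    unfolding bcontfun_def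
    using \<Phi>_cont[OF that] ball[OF that] bounded_subset[OF bounded_cball[of x0 R]] by blast
  have app: "apply_bcontfun (Bcontfun (\<Phi> f)) = \<Phi> f" if "f \<in> S" for f
    using \<Phi>_b[OF that] by (rule Bcontfun_inverse)
  have "\<exists>!f\<in>S. Bcontfun (\<Phi> f) = f"
  proof (rule Banach_fix[where c = "r * L"])
    show "complete S" unfolding S_def complete_eq_closed by (intro closed_PiC) auto
    have "const_bcontfun x0 \<in> S" using R by (auto simp: S_def mem_PiC_iff const_bcontfun.rep_eq)
    then show "S \<noteq> {}" by blast
    show "0 \<le> r * L" "r * L < 1" using r L by auto
    show "(\<lambda>f. Bcontfun (\<Phi> f)) ` S \<subseteq> S"
      using ball app by (auto simp: S_def mem_PiC_iff)
    fix f h assume fh: "f \<in> S" "h \<in> S"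
    show "dist (Bcontfun (\<Phi> f)) (Bcontfun (\<Phi> h)) \<le> r * L * dist f h"
    proof (rule dist_bound)
      fix t
      have "dist (\<Phi> f t) (\<Phi> h t) = norm (integral {0..\<pi> t} (\<lambda>s. F (apply_bcontfun f s) - F (apply_bcontfun h s)))"
        unfolding \<Phi>_def dist_norm
        by (subst integral_diff) (auto intro!: integrable_continuous_real cont fh)
      also have "\<dots> \<le> (L * dist f h) * (\<pi> t - 0)"
      proof (rule integral_bound)
        show "continuous_on {0..\<pi> t} (\<lambda>s. F (apply_bcontfun f s) - F (apply_bcontfun h s))"
          by (intro continuous_intros cont fh)
        fix s
        have "norm (F (apply_bcontfun f s) - F (apply_bcontfun h s)) \<le> L * dist (apply_bcontfun f s) (apply_bcontfun h s)"
          using lipschitz_onD[OF lip inball[OF fh(1)] inball[OF fh(2)]] by (simp add: dist_norm)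
        also have "\<dots> \<le> L * dist f h" using L by (intro mult_left_mono dist_bounded)
        finally show "norm (F (apply_bcontfun f s) - F (apply_bcontfun h s)) \<le> L * dist f h" .
      qed (use \<pi> in auto)
      also have "\<dots> \<le> (L * dist f h) * r" using \<pi>[of t] L by (intro mult_left_mono) auto
      finally show "dist (apply_bcontfun (Bcontfun (\<Phi> f)) t) (apply_bcontfun (Bcontfun (\<Phi> h)) t) \<le> r * L * dist f h"
        using app fh by (simp add: mult_ac)
    qed
  qed
  then obtain f where f: "f \<in> S" "Bcontfun (\<Phi> f) = f" by blast
  let ?u = "\<lambda>t. x0 + integral {0..t} (\<lambda>s. F (apply_bcontfun f s))"
  have fu: "apply_bcontfun f t = ?u t" if "t \<in> {0..r}" for t
  proof -
    have "apply_bcontfun f t = \<Phi> f t" by (metis app f)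
    also have "\<dots> = ?u t" using that by (simp add: \<Phi>_def \<pi>_def)
    finally show ?thesis .
  qed
  show ?thesis
  proof (rule that[of ?u])
    show "?u 0 = x0" by simp
    fix t assume t: "t \<in> {0..r}"
    show "?u t \<in> cball x0 R" using inball[OF f(1), of t] fu[OF t] by simp
    have "(?u has_vector_derivative 0 + F (apply_bcontfun f t)) (at t within {0..r})"
      by (intro has_vector_derivative_add has_vector_derivative_const integral_has_vector_derivative cont f t)
    then show "(?u has_vector_derivative F (?u t)) (at t within {0..r})" using fu[OF t] by simp
  qed
qed

text \<open>Integrals of vector-valued functions are formed in types of class \<^class>\<open>banach\<close>, which the sort
  of \<open>'h\<close> does not entail. The dual of \<open>'h\<close> is of that class, so the equation is solved there
  after transport by the Riesz isometry.\<close>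

lemma picard_lindelof_hilbert:
  fixes F :: "'h::{real_inner, complete_space} \<Rightarrow> 'h"
  assumes lip: "L-lipschitz_on (cball x0 R) F"
    and bound: "\<And>x. x \<in> cball x0 R \<Longrightarrow> norm (F x) \<le> K"
    and r: "0 < r" "r * K \<le> R" "r * L < 1" and R: "0 \<le> R"
  obtains u where "u 0 = x0" "\<And>t. t \<in> {0..r} \<Longrightarrow> u t \<in> cball x0 R"
    "\<And>t. t \<in> {0..r} \<Longrightarrow> (u has_vector_derivative F (u t)) (at t within {0..r})"
proof -
  define J :: "'h \<Rightarrow> 'h \<Rightarrow>\<^sub>L real" where "J = blinfun_inner_left"
  define J' where "J' = inv_into UNIV J"
  have J_add: "J (x + y) = J x + J y" and J_scale: "J (a *\<^sub>R x) = a *\<^sub>R J x" for x y a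
    by (auto simp: J_def inner_add_right blinfun.add_left blinfun.scaleR_left intro!: blinfun_eqI)
  have J_norm: "norm (J x) = norm x" for x by (simp add: J_def norm_blinfun_inner_left)
  have J_lin: "bounded_linear J"
    by (rule bounded_linear_intro[where K = 1]) (auto simp: J_add J_scale J_norm)
  have J_surj: "J (J' l) = l" for l
  proof -
    obtain x where "J x = l" unfolding J_def by (rule riesz_isometry)
    then have "l \<in> range J" by blast
    then show ?thesis unfolding J'_def by (rule f_inv_into_f)
  qed
  have J_diff: "J (x - y) = J x - J y" for x y
    using J_lin bounded_linear.linear linear_diff by blast
  have J_inj: "J x = J y \<Longrightarrow> x = y" for x y
    using J_norm[of "x - y"] by (simp add: J_diff)
  have J'_J: "J' (J x) = x" for x using J_surj J_inj by blast
  have J_dist: "dist (J x) (J y) = dist x y" for x y by (simp add: dist_norm J_diff[symmetric] J_norm)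
  have J'_dist: "dist (J' x) (J' y) = dist x y" for x y by (metis J_dist J_surj)
  have J'_lin: "bounded_linear J'"
  proof (rule bounded_linear_intro[where K = 1])
    show "J' (l + k) = J' l + J' k" for l k by (rule J_inj) (simp add: J_add J_surj)
    show "J' (a *\<^sub>R l) = a *\<^sub>R J' l" for a l by (rule J_inj) (simp add: J_scale J_surj)
    show "norm (J' l) \<le> norm l * 1" for l using J_norm[of "J' l"] by (simp add: J_surj)
  qed
  have ball: "J' y \<in> cball x0 R \<longleftrightarrow> y \<in> cball (J x0) R" for y
    using J'_dist[of "J x0" y] by (simp add: J'_J)
  have "L-lipschitz_on (cball (J x0) R) (\<lambda>y. J (F (J' y)))"
  proof (rule lipschitz_onI)
    fix y z assume "y \<in> cball (J x0) R" "z \<in> cball (J x0) R"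
    then have "dist (F (J' y)) (F (J' z)) \<le> L * dist (J' y) (J' z)"
      using lipschitz_onD[OF lip] ball by blast
    then show "dist (J (F (J' y))) (J (F (J' z))) \<le> L * dist y z"
      by (simp add: J_dist J'_dist)
  qed (use lip lipschitz_on_nonneg in blast)
  then obtain u where u: "u 0 = J x0" "\<And>t. t \<in> {0..r} \<Longrightarrow> u t \<in> cball (J x0) R"
    "\<And>t. t \<in> {0..r} \<Longrightarrow> (u has_vector_derivative J (F (J' (u t)))) (at t within {0..r})"
    by (rule picard_lindelof_banach[where K = K and r = r]) (use bound r R ball J_norm in auto)
  show ?thesis
  proof (rule that[of "\<lambda>t. J' (u t)"])
    show "J' (u 0) = x0" by (simp add: u J'_J)
    fix t assume t: "t \<in> {0..r}"
    show "J' (u t) \<in> cball x0 R" using u(2)[OF t] ball by blast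
    show "((\<lambda>t. J' (u t)) has_vector_derivative F (J' (u t))) (at t within {0..r})"
      using bounded_linear.has_vector_derivative[OF J'_lin u(3)[OF t]] by (simp add: J'_J)
  qed
qed

lemma mvt_within:
  fixes f :: "real \<Rightarrow> real"
  assumes "a < b" and "\<And>x. x \<in> {a..b} \<Longrightarrow> (f has_real_derivative f' x) (at x within {a..b})"
  obtains x where "x \<in> {a<..<b}" "f b - f a = (b - a) * f' x"
proof -
  have "\<exists>x\<in>{a<..<b}. f b - f a = f' x * (b - a)"
    by (rule mvt_simple) (use assms in \<open>auto simp: has_field_derivative_def\<close>)
  then show ?thesis using that by (auto simp: mult.commute)
qed

text \<open>Gronwall's argument: by the Lipschitz bound \<open>\<parallel>u - v\<parallel>\<^sup>2 exp (- 2 L s)\<close> does not increase with \<open>s\<close>.\<close>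

lemma lipschitz_ode_unique:
  fixes u v :: "real \<Rightarrow> 'h::real_inner"
  assumes lip: "L-lipschitz_on D F"
    and u: "\<And>t. t \<in> {a..b} \<Longrightarrow> (u has_vector_derivative F (u t)) (at t within {a..b})"
    and v: "\<And>t. t \<in> {a..b} \<Longrightarrow> (v has_vector_derivative F (v t)) (at t within {a..b})"
    and D: "\<And>t. t \<in> {a..b} \<Longrightarrow> u t \<in> D \<and> v t \<in> D"
    and eq: "u a = v a" and t: "t \<in> {a..b}"
  shows "u t = v t"
proof (cases "t = a")
  case False
  define \<phi> where "\<phi> s = ((u s - v s) \<bullet> (u s - v s)) * exp (- 2 * L * s)" for s
  define \<phi>' where "\<phi>' s = (2 * ((u s - v s) \<bullet> (F (u s) - F (v s)))
      - 2 * L * ((u s - v s) \<bullet> (u s - v s))) * exp (- 2 * L * s)" for s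
  have der: "(\<phi> has_real_derivative \<phi>' s) (at s within {a..t})" if "s \<in> {a..t}" for s
  proof -
    have uv: "((\<lambda>s. u s - v s) has_derivative (\<lambda>h. h *\<^sub>R (F (u s) - F (v s)))) (at s within {a..t})"
      unfolding has_vector_derivative_def[symmetric]
      using that t by (intro has_vector_derivative_diff has_vector_derivative_within_subset[OF u, of s "{a..t}"]
          has_vector_derivative_within_subset[OF v, of s "{a..t}"]) auto
    have sq: "((\<lambda>s. (u s - v s) \<bullet> (u s - v s)) has_real_derivative 2 * ((u s - v s) \<bullet> (F (u s) - F (v s))))
        (at s within {a..t})"
      unfolding has_field_derivative_def
      by (rule has_derivative_eq_rhs[OF has_derivative_inner[OF uv uv]])
        (simp add: fun_eq_iff inner_commute mult.commute)
    have ex: "((\<lambda>s. exp (- 2 * L * s)) has_real_derivative - 2 * L * exp (- 2 * L * s)) (at s within {a..t})"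
      by (auto intro!: derivative_eq_intros)
    show ?thesis
      unfolding \<phi>_def \<phi>'_def by (rule DERIV_cong[OF DERIV_mult[OF sq ex]]) (simp add: algebra_simps)
  qed
  obtain s where s: "s \<in> {a<..<t}" "\<phi> t - \<phi> a = (t - a) * \<phi>' s"
    using mvt_within[OF _ der] False t by (metis atLeastAtMost_iff order_le_less)
  have "\<phi>' s \<le> 0"
  proof -
    have "u s \<in> D" "v s \<in> D" using D[of s] s t by auto
    then have "norm (F (u s) - F (v s)) \<le> L * norm (u s - v s)"
      using lipschitz_onD[OF lip] by (simp add: dist_norm)
    then have "(u s - v s) \<bullet> (F (u s) - F (v s)) \<le> norm (u s - v s) * (L * norm (u s - v s))"
      by (meson mult_left_mono norm_cauchy_schwarz norm_ge_zero order_trans)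
    then show ?thesis unfolding \<phi>'_def
      by (intro mult_nonpos_nonneg) (auto simp: dot_square_norm power2_eq_square mult_ac)
  qed
  then have "\<phi> t \<le> \<phi> a" using s False t by (smt (verit) atLeastAtMost_iff mult_nonneg_nonpos)
  then have "(u t - v t) \<bullet> (u t - v t) * exp (- 2 * L * t) \<le> 0" using eq by (simp add: \<phi>_def)
  then have "(u t - v t) \<bullet> (u t - v t) \<le> 0"
    by (smt (verit) exp_gt_zero mult_pos_pos)
  then have "u t - v t = 0" by (metis inner_ge_zero inner_eq_zero_iff antisym)
  then show ?thesis by simp
qed (use eq in simp)

section \<open>Locally Lipschitz maps\<close>

lemma locally_lipschitz_on_imp_continuous_on:
  assumes "locally_lipschitz_on S f" "open S" shows "continuous_on S f"
proof (rule continuous_at_imp_continuous_on, rule ballI)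
  fix x assume x: "x \<in> S"
  obtain r L where r: "r > 0" "L-lipschitz_on (ball x r \<inter> S) f"
    using assms x unfolding locally_lipschitz_on_def by blast
  have "continuous_on (ball x r \<inter> S) f" by (rule lipschitz_on_continuous_on[OF r(2)])
  then show "isCont f x" using r x assms(2) by (simp add: continuous_on_eq_continuous_at open_Int)
qed

text \<open>Near each point the continuous derivative is bounded, so that the mean value inequality applies.\<close>

lemma C1_on_imp_locally_lipschitz_on:
  assumes "C1_on S f" "open S" shows "locally_lipschitz_on S f"
  unfolding locally_lipschitz_on_def
proof
  fix x assume x: "x \<in> S"
  obtain f' where f': "\<And>x. x \<in> S \<Longrightarrow> (f has_derivative blinfun_apply (f' x)) (at x)" "continuous_on S f'"
    using assms(1) unfolding C1_on_def by blast
  have "isCont f' x" using f'(2) assms(2) x by (simp add: continuous_on_eq_continuous_at)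
  then obtain e where e: "e > 0" "\<And>y. dist y x < e \<Longrightarrow> dist (f' y) (f' x) < 1"
    unfolding continuous_at_eps_delta by (meson zero_less_one)
  obtain r where r: "r > 0" "ball x r \<subseteq> S" using assms(2) x open_contains_ball by blast
  let ?s = "min r e" and ?L = "norm (f' x) + 1"
  have "?L-lipschitz_on (ball x ?s) f"
  proof (rule lipschitz_onI)
    fix y z assume yz: "y \<in> ball x ?s" "z \<in> ball x ?s"
    have "norm (f y - f z) \<le> ?L * norm (y - z)"
    proof (rule differentiable_bound[of "ball x ?s" f "\<lambda>x. blinfun_apply (f' x)"])
      fix w assume w: "w \<in> ball x ?s"
      then have "w \<in> S" using r by auto
      then show "(f has_derivative blinfun_apply (f' w)) (at w within ball x ?s)"
        by (rule has_derivative_at_withinI[OF f'(1)])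
      have "dist (f' w) (f' x) < 1" using e w by (auto simp: dist_commute)
      then have "norm (f' w) \<le> ?L" using norm_triangle_sub[of "f' w" "f' x"] by (simp add: dist_norm)
      then show "onorm (blinfun_apply (f' w)) \<le> ?L" by (simp add: norm_blinfun.rep_eq)
    qed (use yz in auto)
    then show "dist (f y) (f z) \<le> ?L * dist y z" by (simp add: dist_norm)
  qed simp
  then have "?L-lipschitz_on (ball x ?s \<inter> S) f" by (rule lipschitz_on_subset) auto
  then show "\<exists>r>0. \<exists>L. L-lipschitz_on (ball x r \<inter> S) f" using r e by (meson min_less_iff_conj)
qed

text \<open>Subtracting the equations at \<open>y\<close> and \<open>z\<close> and testing with \<open>w = v y - v z\<close> gives
  \<open>B y w w = (l y - l z) w + (B z - B y) (v z) w\<close>. Coercivity at one point \<open>x\<close> persists nearby with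
  half the constant, since \<open>B\<close> is continuous; it first bounds \<open>v\<close> near \<open>x\<close> and then turns the identity
  into a Lipschitz estimate.\<close>

lemma locally_lipschitz_on_solution:
  fixes B :: "'a::metric_space \<Rightarrow> 'h::real_inner \<Rightarrow>\<^sub>L 'h \<Rightarrow>\<^sub>L real" and l :: "'a \<Rightarrow> 'h \<Rightarrow>\<^sub>L real"
  assumes B: "locally_lipschitz_on S B" and l: "locally_lipschitz_on S l"
    and coercive: "\<And>x. x \<in> S \<Longrightarrow> \<exists>m>0. \<forall>h. m * (norm h)\<^sup>2 \<le> B x h h"
    and v: "\<And>x h. x \<in> S \<Longrightarrow> B x (v x) h = l x h"
  shows "locally_lipschitz_on S v"
  unfolding locally_lipschitz_on_def
proof
  fix x assume x: "x \<in> S"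
  obtain r1 L1 where 1: "r1 > 0" "L1-lipschitz_on (ball x r1 \<inter> S) B"
    using B x unfolding locally_lipschitz_on_def by blast
  obtain r2 L2 where 2: "r2 > 0" "L2-lipschitz_on (ball x r2 \<inter> S) l"
    using l x unfolding locally_lipschitz_on_def by blast
  obtain m where m: "m > 0" "\<And>h. m * (norm h)\<^sup>2 \<le> B x h h" using coercive[OF x] by blast
  have L: "L1 \<ge> 0" "L2 \<ge> 0" using 1 2 lipschitz_on_nonneg by blast+
  \<comment> \<open>On this ball \<open>B\<close> differs from \<open>B x\<close> by at most \<open>m / 2\<close>.\<close>
  define r where "r = min (min r1 r2) (m / (2 * (L1 + 1)))"
  have r: "r > 0" using 1 2 m L by (simp add: r_def)
  define U where "U = ball x r \<inter> S"
  have xU: "x \<in> U" using x r by (simp add: U_def)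
  have U: "U \<subseteq> ball x r1 \<inter> S" "U \<subseteq> ball x r2 \<inter> S" by (auto simp: U_def r_def)
  have BL: "norm (B y - B z) \<le> L1 * dist y z" if "y \<in> U" "z \<in> U" for y z
    using lipschitz_onD[OF 1(2) subsetD[OF U(1) that(1)] subsetD[OF U(1) that(2)]] by (simp add: dist_norm)
  have lL: "norm (l y - l z) \<le> L2 * dist y z" if "y \<in> U" "z \<in> U" for y z
    using lipschitz_onD[OF 2(2) subsetD[OF U(2) that(1)] subsetD[OF U(2) that(2)]] by (simp add: dist_norm)
  have est: "blinfun_apply (blinfun_apply C h) h \<ge> - norm C * (norm h)\<^sup>2" for C :: "'h \<Rightarrow>\<^sub>L 'h \<Rightarrow>\<^sub>L real" and h
  proof -
    have "norm (C h h) \<le> norm (C h) * norm h" by (rule norm_blinfun)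
    also have "\<dots> \<le> norm C * norm h * norm h" by (intro mult_right_mono norm_blinfun) auto
    finally show ?thesis by (simp add: power2_eq_square)
  qed
  have co: "m / 2 * (norm h)\<^sup>2 \<le> B y h h" if "y \<in> U" for y h
  proof -
    have "dist y x \<le> m / (2 * (L1 + 1))" using that by (simp add: U_def r_def dist_commute)
    then have "L1 * dist y x \<le> L1 * (m / (2 * (L1 + 1)))" using L by (intro mult_left_mono) auto
    also have "\<dots> \<le> m / 2" using L m by (simp add: field_simps)
    finally have "norm (B y - B x) \<le> m / 2" using BL[OF that xU] by linarith
    then have "norm (B y - B x) * (norm h)\<^sup>2 \<le> m / 2 * (norm h)\<^sup>2" by (intro mult_right_mono) auto
    moreover have "B y h h - B x h h \<ge> - norm (B y - B x) * (norm h)\<^sup>2"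
      using est[of "B y - B x" h] by (simp add: blinfun.diff_left)
    ultimately show ?thesis using m(2)[of h] by (simp add: field_simps)
  qed
  have key: "m / 2 * norm w \<le> C" if "y \<in> U" "B y w w \<le> C * norm w" "C \<ge> 0" for y w C
  proof (cases "w = 0")
    case False
    have "m / 2 * (norm w)\<^sup>2 \<le> C * norm w"
      using co[OF that(1), of w] that(2) by linarith
    then have "(m / 2 * norm w) * norm w \<le> C * norm w"
      by (simp only: power2_eq_square mult.assoc)
    then show ?thesis using False by (intro mult_right_le_imp_le[of "m / 2 * norm w" "norm w" C]) auto
  qed (use that in simp)
  define N where "N = 2 * (norm (l x) + L2 * r) / m"
  have N: "norm (v y) \<le> N" if "y \<in> U" for y
  proof -
    have "L2 * dist y x \<le> L2 * r" using that L by (intro mult_left_mono) (auto simp: U_def dist_commute)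
    then have "norm (l y) \<le> norm (l x) + L2 * r"
      using lL[OF that xU] norm_triangle_sub[of "l y" "l x"] by linarith
    moreover have "B y (v y) (v y) \<le> norm (l y) * norm (v y)"
      using v[of y "v y"] that norm_blinfun[of "l y" "v y"] by (auto simp: U_def)
    ultimately have "m / 2 * norm (v y) \<le> norm (l x) + L2 * r"
      using key[OF that, of "v y" "norm (l y)"] by simp
    then show ?thesis using m by (simp add: N_def field_simps)
  qed
  have N0: "N \<ge> 0" using N[OF xU] norm_ge_zero order_trans by blast
  define L where "L = 2 * (L2 + L1 * N) / m"
  have "L-lipschitz_on U v"
  proof (rule lipschitz_onI)
    fix y z assume yz: "y \<in> U" "z \<in> U"
    define w where "w = v y - v z"
    have "B y w w = (l y - l z) w + (B z - B y) (v z) w"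
      using v[of y w] v[of z w] yz by (simp add: U_def w_def blinfun.diff_left blinfun.diff_right)
    also have "(l y - l z) w \<le> (L2 * dist y z) * norm w"
      by (rule order_trans[OF abs_ge_self[of "(l y - l z) w"]])
        (use norm_blinfun[of "l y - l z" w] lL[OF yz] in \<open>simp, meson mult_right_mono norm_ge_zero order_trans\<close>)
    also have "(B z - B y) (v z) w \<le> (L1 * dist y z * N) * norm w"
    proof -
      have "norm ((B z - B y) (v z) w) \<le> norm ((B z - B y) (v z)) * norm w" by (rule norm_blinfun)
      also have "\<dots> \<le> (norm (B z - B y) * norm (v z)) * norm w" by (intro mult_right_mono norm_blinfun) auto
      also have "\<dots> \<le> (L1 * dist y z * N) * norm w"
        using BL[OF yz(2,1)] N[OF yz(2)] L
        by (intro mult_right_mono mult_mono) (auto simp: dist_commute)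
      finally show ?thesis by simp
    qed
    finally have "m / 2 * norm w \<le> L2 * dist y z + L1 * dist y z * N"
      using L N0 by (intro key[OF yz(1)]) (auto simp: algebra_simps)
    then show "dist (v y) (v z) \<le> L * dist y z"
      using m by (simp add: L_def w_def dist_norm field_simps)
  qed (use L N0 m in \<open>simp add: L_def\<close>)
  then show "\<exists>r>0. \<exists>L. L-lipschitz_on (ball x r \<inter> S) v" using r unfolding U_def by blast
qed

section \<open>Curves in topological spaces, derivatives and integrals on the line\<close>

lemma atin_top_of_set_eq_at_within:
  assumes "t \<in> I" shows "atin (top_of_set I) t = at t within I"
proof (rule filter_eqI)
  fix P
  show "eventually P (atin (top_of_set I) t) \<longleftrightarrow> eventually P (at t within I)"
    using assms by (auto simp: atin_subtopology_within eventually_atin_within eventually_at_topological)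
qed

text \<open>Continuity of a curve, expressed by the filter that also governs its one-sided derivatives.\<close>

lemma continuous_map_top_of_set_iff_limitin:
  "continuous_map (top_of_set I) M \<xi> \<longleftrightarrow> (\<forall>t\<in>I. limitin M \<xi> (\<xi> t) (at t within I))"
  by (auto simp: continuous_map_atin atin_top_of_set_eq_at_within)

lemma continuous_map_top_of_set_locally:
  assumes "\<And>t. t \<in> I \<Longrightarrow> \<exists>U. open U \<and> t \<in> U \<and> continuous_map (top_of_set (I \<inter> U)) M \<xi>"
  shows "continuous_map (top_of_set I) M \<xi>"
  unfolding continuous_map_top_of_set_iff_limitin
proof
  fix t assume t: "t \<in> I"
  obtain U where U: "open U" "t \<in> U" "continuous_map (top_of_set (I \<inter> U)) M \<xi>"
    using assms[OF t] by blast
  have "at t within I = at t within (I \<inter> U)"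
    by (rule at_within_nhd[of t U]) (use U in auto)
  then show "limitin M \<xi> (\<xi> t) (at t within I)"
    using U t by (simp add: continuous_map_top_of_set_iff_limitin)
qed

lemma has_derivative_cong_nhds:
  assumes "\<forall>\<^sub>F y in nhds x. f y = g y"
  shows "(f has_derivative f') (at x) \<longleftrightarrow> (g has_derivative f') (at x)"
proof -
  have "f x = g x" using eventually_nhds_x_imp_x[OF assms] .
  moreover have "\<forall>\<^sub>F y in at x. f y = g y" using assms by (simp add: eventually_at_filter eventually_mono)
  ultimately show ?thesis
    using has_derivative_transform_eventually[of f f' x UNIV g]
      has_derivative_transform_eventually[of g f' x UNIV f]
    by (metis (mono_tags, lifting) UNIV_I eventually_mono)
qed

lemma has_vector_derivative_within_Un:
  assumes "(f has_vector_derivative D) (at t within S)" "(f has_vector_derivative D) (at t within T)"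
  shows "(f has_vector_derivative D) (at t within S \<union> T)"
  using assms unfolding has_vector_derivative_def has_derivative_within
  by (simp add: at_within_union filterlim_sup)

lemma integral_nonneg_real:
  fixes f :: "real \<Rightarrow> real"
  assumes "\<And>x. x \<in> S \<Longrightarrow> 0 \<le> f x" shows "0 \<le> integral S f"
  by (cases "f integrable_on S") (simp_all add: integral_nonneg assms not_integrable_integral)

text \<open>The majorant is the only function that has to be integrable, as the integral of a function that is
  not integrable is 0.\<close>

lemma integral_le_majorant:
  fixes f \<psi> :: "real \<Rightarrow> real"
  assumes \<psi>: "(\<psi> has_integral J) S" and "\<And>x. x \<in> S \<Longrightarrow> 0 \<le> f x" "\<And>x. x \<in> S \<Longrightarrow> f x \<le> \<psi> x"
  shows "integral S f \<le> J"
proof (cases "f integrable_on S")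
  case True
  then show ?thesis by (rule has_integral_le[OF integrable_integral \<psi> assms(3)])
next
  case False
  have "0 \<le> \<psi> x" if "x \<in> S" for x using assms(2,3)[OF that] by linarith
  then have "0 \<le> J" by (rule has_integral_nonneg[OF \<psi>])
  then show ?thesis using False by (simp add: not_integrable_integral)
qed

section \<open>Charts\<close>

locale hilbert_manifold =
  fixes M :: "'a topology" and A :: "('a, 'h::{real_inner, complete_space}) chart set"
  assumes manifold: "hilbert_manifold_C2 M A"
begin

lemma Hausdorff: "Hausdorff_space M"
  using manifold by (simp add: hilbert_manifold_C2_def)

lemma chart_exists: "p \<in> topspace M \<Longrightarrow> \<exists>c\<in>A. p \<in> chart_dom c"
  using manifold by (auto simp: hilbert_manifold_C2_def)

lemma openin_chart_dom: "c \<in> A \<Longrightarrow> openin M (chart_dom c)"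
  using manifold by (simp add: hilbert_manifold_C2_def)

lemma chart_dom_topspace: "c \<in> A \<Longrightarrow> p \<in> chart_dom c \<Longrightarrow> p \<in> topspace M"
  using openin_chart_dom openin_subset by blast

lemma open_chart_image: "c \<in> A \<Longrightarrow> open (chart_map c ` chart_dom c)"
  using manifold by (simp add: hilbert_manifold_C2_def)

lemma homeomorphic_chart:
  "c \<in> A \<Longrightarrow>
    homeomorphic_map (subtopology M (chart_dom c)) (top_of_set (chart_map c ` chart_dom c)) (chart_map c)"
  using manifold by (simp add: hilbert_manifold_C2_def)

lemma topspace_chart_subtopology: "c \<in> A \<Longrightarrow> topspace (subtopology M (chart_dom c)) = chart_dom c"
  using openin_chart_dom[of c] openin_subset by fastforce

lemma inj_on_chart: "c \<in> A \<Longrightarrow> inj_on (chart_map c) (chart_dom c)"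
  using homeomorphic_imp_injective_map[OF homeomorphic_chart] topspace_chart_subtopology by auto

lemma chart_inv_map: "c \<in> A \<Longrightarrow> p \<in> chart_dom c \<Longrightarrow> chart_inv c (chart_map c p) = p"
  by (simp add: chart_inv_def inj_on_chart)

lemma chart_map_inv: "x \<in> chart_map c ` chart_dom c \<Longrightarrow> chart_map c (chart_inv c x) = x"
  by (simp add: chart_inv_def f_inv_into_f)

lemma chart_inv_in_dom: "x \<in> chart_map c ` chart_dom c \<Longrightarrow> chart_inv c x \<in> chart_dom c"
  by (simp add: chart_inv_def inv_into_into)

lemma open_chart_image_Int:
  assumes "c \<in> A" "openin M W" shows "open (chart_map c ` (chart_dom c \<inter> W))"
proof -
  have "openin (subtopology M (chart_dom c)) (chart_dom c \<inter> W)"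
    by (metis assms(2) inf_commute openin_subtopology_Int)
  then have "openin (top_of_set (chart_map c ` chart_dom c)) (chart_map c ` (chart_dom c \<inter> W))"
    using homeomorphic_imp_open_map[OF homeomorphic_chart[OF assms(1)]] open_map_def by blast
  then show ?thesis using open_chart_image[OF assms(1)] openin_open_trans by blast
qed

lemma openin_chart_preimage:
  assumes "c \<in> A" "open U" shows "openin M {p \<in> chart_dom c. chart_map c p \<in> U}"
proof -
  have cont: "continuous_map (subtopology M (chart_dom c)) (top_of_set (chart_map c ` chart_dom c)) (chart_map c)"
    using homeomorphic_chart[OF assms(1)] homeomorphic_imp_continuous_map by blast
  have "openin (top_of_set (chart_map c ` chart_dom c)) (chart_map c ` chart_dom c \<inter> U)"
    using assms(2) by (simp add: openin_open_Int)
  then have "openin (subtopology M (chart_dom c))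
      {p \<in> topspace (subtopology M (chart_dom c)). chart_map c p \<in> chart_map c ` chart_dom c \<inter> U}"
    using cont openin_continuous_map_preimage by blast
  moreover have "{p \<in> topspace (subtopology M (chart_dom c)). chart_map c p \<in> chart_map c ` chart_dom c \<inter> U}
      = {p \<in> chart_dom c. chart_map c p \<in> U}"
    using topspace_chart_subtopology[OF assms(1)] by auto
  ultimately show ?thesis
    using openin_chart_dom[OF assms(1)] by (simp add: openin_open_subtopology)
qed

lemma limitin_chart:
  assumes "limitin M f p F" "c \<in> A" "p \<in> chart_dom c"
  shows "\<forall>\<^sub>F s in F. f s \<in> chart_dom c" "((\<lambda>s. chart_map c (f s)) \<longlongrightarrow> chart_map c p) F"
proof -
  show "\<forall>\<^sub>F s in F. f s \<in> chart_dom c"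
    using assms openin_chart_dom by (auto simp: limitin_def)
  show "((\<lambda>s. chart_map c (f s)) \<longlongrightarrow> chart_map c p) F"
  proof (rule topological_tendstoI)
    fix U assume "open U" "chart_map c p \<in> U"
    then have "openin M {q \<in> chart_dom c. chart_map c q \<in> U}" "p \<in> {q \<in> chart_dom c. chart_map c q \<in> U}"
      using assms openin_chart_preimage by blast+
    then have "\<forall>\<^sub>F s in F. f s \<in> {q \<in> chart_dom c. chart_map c q \<in> U}"
      using assms(1) unfolding limitin_def by blast
    then show "\<forall>\<^sub>F s in F. chart_map c (f s) \<in> U" by eventually_elim auto
  qed
qed

lemma limitin_chart_inv:
  assumes "(u \<longlongrightarrow> x) F" "c \<in> A" "x \<in> chart_map c ` chart_dom c"
  shows "limitin M (\<lambda>s. chart_inv c (u s)) (chart_inv c x) F"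
  unfolding limitin_def
proof (intro conjI allI impI)
  show "chart_inv c x \<in> topspace M"
    by (rule chart_dom_topspace[OF assms(2) chart_inv_in_dom[OF assms(3)]])
  fix W assume W: "openin M W \<and> chart_inv c x \<in> W"
  have "x = chart_map c (chart_inv c x)" using chart_map_inv[OF assms(3)] by simp
  moreover have "chart_inv c x \<in> chart_dom c \<inter> W" using W chart_inv_in_dom[OF assms(3)] by blast
  ultimately have "x \<in> chart_map c ` (chart_dom c \<inter> W)" by (rule image_eqI)
  then have "\<forall>\<^sub>F s in F. u s \<in> chart_map c ` (chart_dom c \<inter> W)"
    using topological_tendstoD[OF assms(1) open_chart_image_Int[OF assms(2), of W]] W by blast
  then show "\<forall>\<^sub>F s in F. chart_inv c (u s) \<in> W"
    by eventually_elim (auto simp: chart_inv_map[OF assms(2)])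
qed

lemma eventually_nhds_chart:
  assumes "c \<in> A" "p \<in> chart_dom c" "openin M W" "p \<in> W"
  shows "\<forall>\<^sub>F x in nhds (chart_map c p). x \<in> chart_map c ` chart_dom c \<and> chart_inv c x \<in> W"
proof -
  have "chart_map c p \<in> chart_map c ` (chart_dom c \<inter> W)" using assms by blast
  then have "\<forall>\<^sub>F x in nhds (chart_map c p). x \<in> chart_map c ` (chart_dom c \<inter> W)"
    using open_chart_image_Int[OF assms(1,3)] eventually_nhds_in_open by blast
  then show ?thesis by eventually_elim (auto simp: chart_inv_map[OF assms(1)])
qed

section \<open>Tangent spaces\<close>

definition chart_change :: "('a, 'h) chart \<Rightarrow> ('a, 'h) chart \<Rightarrow> 'a \<Rightarrow> 'h \<Rightarrow> 'h" where
  "chart_change c d p = frechet_derivative (transition c d) (at (chart_map c p))"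

lemma has_derivative_transition:
  assumes "c \<in> A" "d \<in> A" "p \<in> chart_dom c" "p \<in> chart_dom d"
  shows "(transition c d has_derivative chart_change c d p) (at (chart_map c p))"
proof -
  have "C2_on (chart_map c ` (chart_dom c \<inter> chart_dom d)) (transition c d)"
    using manifold assms by (simp add: hilbert_manifold_C2_def)
  then obtain f' where f': "(transition c d has_derivative f') (at (chart_map c p))"
    unfolding C2_on_def using assms by blast
  then show ?thesis unfolding chart_change_def frechet_derivative_at[OF f', symmetric] .
qed

lemma linear_chart_change:
  assumes "c \<in> A" "d \<in> A" "p \<in> chart_dom c" "p \<in> chart_dom d"
  shows "linear (chart_change c d p)"
  using has_derivative_transition[OF assms] has_derivative_linear by blast

text \<open>The chain rule that makes all derivatives on the manifold independent of the chart: it applies to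
  real functions and to coordinate maps alike.\<close>

lemma has_derivative_change_of_chart:
  assumes "c \<in> A" "d \<in> A" "p \<in> chart_dom c" "p \<in> chart_dom d"
    and f: "((f \<circ> chart_inv c) has_derivative f') (at (chart_map c p))"
  shows "((f \<circ> chart_inv d) has_derivative (\<lambda>h. f' (chart_change d c p h))) (at (chart_map d p))"
proof -
  have tr: "transition d c (chart_map d p) = chart_map c p"
    using assms by (simp add: transition_def chart_inv_map)
  have "((\<lambda>x. (f \<circ> chart_inv c) (transition d c x)) has_derivative (\<lambda>h. f' (chart_change d c p h))) (at (chart_map d p))"
    by (rule has_derivative_compose[OF has_derivative_transition[OF assms(2,1,4,3)]]) (simp only: tr f)
  moreover have "\<forall>\<^sub>F x in nhds (chart_map d p). (f \<circ> chart_inv c) (transition d c x) = (f \<circ> chart_inv d) x"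
    using eventually_nhds_chart[OF assms(2,4) openin_chart_dom[OF assms(1)] assms(3)]
    by eventually_elim (use assms in \<open>simp add: transition_def chart_inv_map\<close>)
  ultimately show ?thesis
    by (simp only: has_derivative_cong_nhds)
qed

lemma chart_change_chain:
  assumes "c \<in> A" "d \<in> A" "e \<in> A" "p \<in> chart_dom c" "p \<in> chart_dom d" "p \<in> chart_dom e"
  shows "chart_change c e p h = chart_change d e p (chart_change c d p h)"
proof -
  have "((chart_map e \<circ> chart_inv d) has_derivative chart_change d e p) (at (chart_map d p))"
    using has_derivative_transition[of d e p] assms by (simp add: transition_def)
  from has_derivative_change_of_chart[OF assms(2,1,5,4) this]
  have "(transition c e has_derivative (\<lambda>h. chart_change d e p (chart_change c d p h))) (at (chart_map c p))"
    by (simp add: transition_def)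
  then show ?thesis
    by (rule fun_cong[OF has_derivative_unique[OF has_derivative_transition[OF assms(1,3,4,6)]]])
qed

lemma chart_change_self:
  assumes "c \<in> A" "p \<in> chart_dom c" shows "chart_change c c p h = h"
proof -
  have "((\<lambda>x. x) has_derivative (\<lambda>h. h)) (at (chart_map c p))" by (rule has_derivative_ident)
  moreover have "\<forall>\<^sub>F x in nhds (chart_map c p). x = transition c c x"
    using eventually_nhds_chart[OF assms openin_chart_dom[OF assms(1)] assms(2)]
    by eventually_elim (simp add: transition_def chart_map_inv)
  ultimately have "(transition c c has_derivative (\<lambda>h. h)) (at (chart_map c p))"
    by (simp only: has_derivative_cong_nhds)
  then show ?thesis
    by (rule fun_cong[OF has_derivative_unique[OF has_derivative_transition[OF assms(1,1,2,2)]]])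
qed

lemma tangent_change:
  assumes "v \<in> tangent_space A p" "c \<in> A" "d \<in> A" "p \<in> chart_dom c" "p \<in> chart_dom d"
  shows "v d = chart_change c d p (v c)"
  using assms unfolding tangent_space_def chart_change_def by blast

lemma tangent_eqI:
  assumes "v \<in> tangent_space A p" "w \<in> tangent_space A p" "c \<in> A" "p \<in> chart_dom c" "v c = w c"
  shows "v = w"
proof
  fix d show "v d = w d"
  proof (cases "d \<in> A \<and> p \<in> chart_dom d")
    case True then show ?thesis
      using tangent_change[OF assms(1) assms(3), of d] tangent_change[OF assms(2) assms(3), of d] assms by simp
  next
    case False then show ?thesis
      using assms(1,2) unfolding tangent_space_def mem_Collect_eq by metis
  qed
qed

lemma tangent_spaceI:
  assumes "c \<in> A" "p \<in> chart_dom c"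
    and "\<And>d. d \<in> A \<Longrightarrow> p \<in> chart_dom d \<Longrightarrow> v d = chart_change c d p (v c)"
    and "\<And>d. \<not> (d \<in> A \<and> p \<in> chart_dom d) \<Longrightarrow> v d = 0"
  shows "v \<in> tangent_space A p"
  unfolding tangent_space_def mem_Collect_eq
proof (intro conjI allI ballI impI)
  fix d e assume d: "d \<in> A" and e: "e \<in> A" and p: "p \<in> chart_dom d \<inter> chart_dom e"
  then show "v e = frechet_derivative (transition d e) (at (chart_map d p)) (v d)"
    using assms(3)[of d] assms(3)[of e] chart_change_chain[OF assms(1) d e assms(2)]
    by (simp add: chart_change_def)
qed (rule assms(4))

text \<open>A chart around \<open>p\<close> identifies the tangent space at \<open>p\<close> with the model space; the lift inverts
  the evaluation of tangent vectors in the chart \<open>c\<close>.\<close>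

definition tangent_lift :: "('a, 'h) chart \<Rightarrow> 'a \<Rightarrow> 'h \<Rightarrow> ('a, 'h) tangent" where
  "tangent_lift c p h = (\<lambda>d. if d \<in> A \<and> p \<in> chart_dom d then chart_change c d p h else 0)"

lemma tangent_lift:
  assumes "c \<in> A" "p \<in> chart_dom c"
  shows "tangent_lift c p h \<in> tangent_space A p" "tangent_lift c p h c = h"
proof -
  show *: "tangent_lift c p h c = h" using assms by (simp add: tangent_lift_def chart_change_self)
  show "tangent_lift c p h \<in> tangent_space A p"
    by (rule tangent_spaceI[OF assms]) (use assms * in \<open>auto simp: tangent_lift_def chart_change_self\<close>)
qed

lemma tangent_combination:
  assumes p: "p \<in> topspace M" and v: "v \<in> tangent_space A p" and w: "w \<in> tangent_space A p"
  shows "(\<lambda>c. a *\<^sub>R v c + b *\<^sub>R w c) \<in> tangent_space A p"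
proof -
  obtain c where c: "c \<in> A" "p \<in> chart_dom c" using chart_exists[OF p] by blast
  show ?thesis
  proof (rule tangent_spaceI[OF c])
    fix d assume d: "d \<in> A" "p \<in> chart_dom d"
    then show "a *\<^sub>R v d + b *\<^sub>R w d = chart_change c d p (a *\<^sub>R v c + b *\<^sub>R w c)"
      using tangent_change[OF v c(1) d(1) c(2) d(2)] tangent_change[OF w c(1) d(1) c(2) d(2)]
        linear_chart_change[OF c(1) d(1) c(2) d(2)]
      by (simp add: linear_add linear_scale)
  qed (use v w in \<open>auto simp: tangent_space_def\<close>)
qed

lemma tangent_scale: "p \<in> topspace M \<Longrightarrow> v \<in> tangent_space A p \<Longrightarrow> (\<lambda>c. a *\<^sub>R v c) \<in> tangent_space A p"
  using tangent_combination[of p v v a 0] by simp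

lemma tangent_uminus: "p \<in> topspace M \<Longrightarrow> v \<in> tangent_space A p \<Longrightarrow> (\<lambda>c. - v c) \<in> tangent_space A p"
  using tangent_scale[of p v "-1"] by simp

lemma tangent_zero: "p \<in> topspace M \<Longrightarrow> (\<lambda>_. 0) \<in> tangent_space A p"
  using chart_exists[of p] tangent_lift(1)[of _ p 0] tangent_scale[of p "tangent_lift _ p 0" 0] by auto

lemma chart_at:
  assumes "p \<in> topspace M" shows "chart_at A p \<in> A" "p \<in> chart_dom (chart_at A p)"
proof -
  have "\<exists>c. c \<in> A \<and> p \<in> chart_dom c" using chart_exists[OF assms] by blast
  then have "chart_at A p \<in> A \<and> p \<in> chart_dom (chart_at A p)"
    unfolding chart_at_def by (rule someI_ex)
  then show "chart_at A p \<in> A" "p \<in> chart_dom (chart_at A p)" by blast+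
qed

lemma frechet_derivative_chart_at:
  assumes p: "c \<in> A" "p \<in> chart_dom c" and v: "v \<in> tangent_space A p"
    and f: "((f \<circ> chart_inv c) has_derivative f') (at (chart_map c p))"
  shows "frechet_derivative (f \<circ> chart_inv (chart_at A p)) (at (chart_map (chart_at A p) p)) (v (chart_at A p)) = f' (v c)"
proof -
  let ?c = "chart_at A p"
  have c: "?c \<in> A" "p \<in> chart_dom ?c" using chart_at p chart_dom_topspace by auto
  have "frechet_derivative (f \<circ> chart_inv ?c) (at (chart_map ?c p)) = (\<lambda>h. f' (chart_change ?c c p h))"
    by (rule frechet_derivative_at[OF has_derivative_change_of_chart[OF p(1) c(1) p(2) c(2) f], symmetric])
  then show ?thesis using tangent_change[OF v c(1) p(1) c(2) p(2)] by simp
qed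

lemma differential_eq:
  assumes "c \<in> A" "p \<in> chart_dom c" "v \<in> tangent_space A p"
    and "((f \<circ> chart_inv c) has_derivative f') (at (chart_map c p))"
  shows "differential A f p v = f' (v c)"
  using frechet_derivative_chart_at[OF assms] by (simp add: differential_def Let_def)

lemma tangent_map_eq:
  assumes "c \<in> A" "p \<in> chart_dom c" "v \<in> tangent_space A p" "d \<in> A" "f p \<in> chart_dom d"
    and "((chart_map d \<circ> f \<circ> chart_inv c) has_derivative f') (at (chart_map c p))"
  shows "tangent_map A f p v d = f' (v c)"
  using frechet_derivative_chart_at[OF assms(1-3) assms(6)] assms(4,5) by (simp add: tangent_map_def Let_def)

section \<open>Curves and maps in charts\<close>

lemma curve_derivative:
  assumes "continuous_map (top_of_set I) M \<gamma>" "t \<in> I" "c \<in> A" "\<gamma> t \<in> chart_dom c"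
    and \<gamma>: "((chart_map c \<circ> \<gamma>) has_vector_derivative w) (at t within I)"
    and f: "((f \<circ> chart_inv c) has_derivative f') (at (chart_map c (\<gamma> t)))"
  shows "((f \<circ> \<gamma>) has_vector_derivative f' w) (at t within I)"
proof -
  have "(((f \<circ> chart_inv c) \<circ> (chart_map c \<circ> \<gamma>)) has_vector_derivative f' w) (at t within I)"
    by (rule vector_derivative_diff_chain_within[OF \<gamma>])
      (simp only: o_apply[of "chart_map c"], rule has_derivative_at_withinI[OF f])
  moreover have "limitin M \<gamma> (\<gamma> t) (at t within I)"
    using assms(1,2) by (simp add: continuous_map_top_of_set_iff_limitin)
  from limitin_chart(1)[OF this assms(3,4)]
  have "\<forall>\<^sub>F s in at t within I. ((f \<circ> chart_inv c) \<circ> (chart_map c \<circ> \<gamma>)) s = (f \<circ> \<gamma>) s"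
    by eventually_elim (simp add: chart_inv_map[OF assms(3)])
  ultimately show ?thesis
    unfolding has_vector_derivative_def
    by (rule has_derivative_transform_eventually) (simp_all add: assms(2,4) chart_inv_map[OF assms(3)])
qed

lemma curve_derivative_chart:
  assumes "continuous_map (top_of_set I) M \<gamma>" "t \<in> I" "c \<in> A" "\<gamma> t \<in> chart_dom c" "d \<in> A" "\<gamma> t \<in> chart_dom d"
    and "((chart_map c \<circ> \<gamma>) has_vector_derivative w) (at t within I)"
  shows "((chart_map d \<circ> \<gamma>) has_vector_derivative chart_change c d (\<gamma> t) w) (at t within I)"
  using curve_derivative[OF assms(1-4,7), of "chart_map d" "chart_change c d (\<gamma> t)"]
    has_derivative_transition[OF assms(3,5,4,6)] by (simp add: transition_def)

lemma velocity_in_tangent_space: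
  assumes \<gamma>: "C1_curve M A I \<gamma>" and t: "t \<in> I" "at t within I \<noteq> bot"
  shows "velocity A I \<gamma> t \<in> tangent_space A (\<gamma> t)"
proof -
  have cont: "continuous_map (top_of_set I) M \<gamma>" using \<gamma> by (simp add: C1_curve_def)
  then have "\<gamma> t \<in> topspace M" using t by (auto simp: continuous_map_def)
  then obtain c where c: "c \<in> A" "\<gamma> t \<in> chart_dom c" using chart_exists by blast
  then obtain w where w: "((chart_map c \<circ> \<gamma>) has_vector_derivative w) (at t within I)"
    using \<gamma> t by (auto simp: C1_curve_def)
  have "vector_derivative (chart_map d \<circ> \<gamma>) (at t within I) = chart_change c d (\<gamma> t) w"
    if "d \<in> A" "\<gamma> t \<in> chart_dom d" for d
    by (rule vector_derivative_within[OF t(2) curve_derivative_chart[OF cont t(1) c that w]])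
  then show ?thesis
    by (intro tangent_spaceI[OF c]) (auto simp: velocity_def c chart_change_self)
qed

lemma C1_map_chart:
  assumes "C1_map M A f" "c \<in> A" "d \<in> A" "p \<in> chart_dom c" "f p \<in> chart_dom d"
  obtains f' where "((chart_map d \<circ> f \<circ> chart_inv c) has_derivative f') (at (chart_map c p))"
proof -
  have "C1_on (chart_map c ` {p \<in> chart_dom c. f p \<in> chart_dom d}) (chart_map d \<circ> f \<circ> chart_inv c)"
    using assms(1-3) unfolding C1_map_def by blast
  moreover have "chart_map c p \<in> chart_map c ` {p \<in> chart_dom c. f p \<in> chart_dom d}"
    using assms(4,5) by blast
  ultimately show ?thesis using that unfolding C1_on_def by blast
qed

text \<open>The chain rule for \<open>\<phi> \<circ> f\<close> with the derivative of \<open>f\<close> read in two charts. With \<open>\<phi>\<close> a coordinate map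
  it shows that tangent maps take values in tangent spaces and are functorial; with \<open>\<phi> = E\<close> it
  differentiates the invariance of \<open>E\<close>.\<close>

lemma has_derivative_chart_compose:
  assumes f: "continuous_map M M f" and c: "c \<in> A" "p \<in> chart_dom c" and d: "d \<in> A" "f p \<in> chart_dom d"
    and f': "((chart_map d \<circ> f \<circ> chart_inv c) has_derivative f') (at (chart_map c p))"
    and \<phi>: "((\<phi> \<circ> chart_inv d) has_derivative \<phi>') (at (chart_map d (f p)))"
  shows "((\<phi> \<circ> f \<circ> chart_inv c) has_derivative (\<lambda>h. \<phi>' (f' h))) (at (chart_map c p))"
proof -
  let ?W = "{q \<in> topspace M. f q \<in> chart_dom d}"
  have eq: "(chart_map d \<circ> f \<circ> chart_inv c) (chart_map c p) = chart_map d (f p)"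
    by (simp add: chart_inv_map[OF c])
  have "((\<lambda>x. (\<phi> \<circ> chart_inv d) ((chart_map d \<circ> f \<circ> chart_inv c) x)) has_derivative (\<lambda>h. \<phi>' (f' h))) (at (chart_map c p))"
    by (rule has_derivative_compose[OF f']) (simp only: eq \<phi>)
  moreover have "openin M ?W" by (rule openin_continuous_map_preimage[OF f openin_chart_dom[OF d(1)]])
  moreover have "p \<in> ?W" using chart_dom_topspace[OF c] d(2) by simp
  from eventually_nhds_chart[OF c \<open>openin M ?W\<close> this]
  have "\<forall>\<^sub>F x in nhds (chart_map c p).
      (\<phi> \<circ> f \<circ> chart_inv c) x = (\<phi> \<circ> chart_inv d) ((chart_map d \<circ> f \<circ> chart_inv c) x)"
    by eventually_elim (simp add: chart_inv_map[OF d(1)])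
  ultimately show ?thesis by (simp only: has_derivative_cong_nhds)
qed

lemma C1_map_continuous: "C1_map M A f \<Longrightarrow> continuous_map M M f"
  by (simp add: C1_map_def)

lemma tangent_map_in_tangent_space:
  assumes f: "C1_map M A f" and p: "p \<in> topspace M" and v: "v \<in> tangent_space A p"
  shows "tangent_map A f p v \<in> tangent_space A (f p)"
proof -
  have "f p \<in> topspace M" using C1_map_continuous[OF f] p by (auto simp: continuous_map_def)
  then obtain d where d: "d \<in> A" "f p \<in> chart_dom d" using chart_exists by blast
  obtain c where c: "c \<in> A" "p \<in> chart_dom c" using chart_exists[OF p] by blast
  obtain f' where f': "((chart_map d \<circ> f \<circ> chart_inv c) has_derivative f') (at (chart_map c p))"
    by (rule C1_map_chart[OF f c(1) d(1) c(2) d(2)])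
  show ?thesis
  proof (rule tangent_spaceI[OF d])
    fix e assume e: "e \<in> A" "f p \<in> chart_dom e"
    have "((chart_map e \<circ> f \<circ> chart_inv c) has_derivative (\<lambda>h. chart_change d e (f p) (f' h))) (at (chart_map c p))"
      by (rule has_derivative_chart_compose[OF C1_map_continuous[OF f] c d f'])
        (use has_derivative_transition[OF d(1) e(1) d(2) e(2)] in \<open>simp add: transition_def\<close>)
    then show "tangent_map A f p v e = chart_change d e (f p) (tangent_map A f p v d)"
      using tangent_map_eq[where f = f, OF c v e] tangent_map_eq[where f = f, OF c v d f'] by simp
  next
    fix e assume "\<not> (e \<in> A \<and> f p \<in> chart_dom e)"
    then show "tangent_map A f p v e = 0" unfolding tangent_map_def by (rule if_not_P)
  qed
qed

text \<open>The chain rule for \<open>f \<circ> f2 = id\<close>. It makes the tangent maps of a diffeomorphism surjective.\<close>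

lemma tangent_map_right_inverse:
  assumes f: "C1_map M A f" and f2: "C1_map M A f2" and inv: "\<And>q. q \<in> topspace M \<Longrightarrow> f (f2 q) = q"
    and q: "q \<in> topspace M" and w: "w \<in> tangent_space A q"
  shows "tangent_map A f (f2 q) (tangent_map A f2 q w) = w"
proof -
  have p: "f2 q \<in> topspace M" using C1_map_continuous[OF f2] q by (auto simp: continuous_map_def)
  obtain c where c: "c \<in> A" "q \<in> chart_dom c" using chart_exists[OF q] by blast
  obtain d where d: "d \<in> A" "f2 q \<in> chart_dom d" using chart_exists[OF p] by blast
  have fc: "f (f2 q) \<in> chart_dom c" using c(2) inv[OF q] by simp
  have v: "tangent_map A f2 q w \<in> tangent_space A (f2 q)" by (rule tangent_map_in_tangent_space[OF f2 q w])
  obtain a where a: "((chart_map d \<circ> f2 \<circ> chart_inv c) has_derivative a) (at (chart_map c q))"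
    by (rule C1_map_chart[OF f2 c(1) d(1) c(2) d(2)])
  obtain b where b: "((chart_map c \<circ> f \<circ> chart_inv d) has_derivative b) (at (chart_map d (f2 q)))"
    by (rule C1_map_chart[OF f d(1) c(1) d(2) fc])
  have "((chart_map c \<circ> f \<circ> f2 \<circ> chart_inv c) has_derivative (\<lambda>h. b (a h))) (at (chart_map c q))"
    by (rule has_derivative_chart_compose[OF C1_map_continuous[OF f2] c d a b])
  moreover have "\<forall>\<^sub>F x in nhds (chart_map c q). (chart_map c \<circ> f \<circ> f2 \<circ> chart_inv c) x = x"
    using eventually_nhds_chart[OF c openin_topspace q]
    by eventually_elim (simp add: inv chart_map_inv)
  ultimately have "((\<lambda>x. x) has_derivative (\<lambda>h. b (a h))) (at (chart_map c q))"
    by (simp only: has_derivative_cong_nhds)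
  then have ba: "b (a h) = h" for h
    using has_derivative_unique[OF _ has_derivative_ident] by (metis (no_types))
  have "tangent_map A f (f2 q) (tangent_map A f2 q w) c = w c"
    using tangent_map_eq[where f = f, OF d v c(1) fc b] tangent_map_eq[where f = f2, OF c w d a] ba by simp
  moreover have "tangent_map A f (f2 q) (tangent_map A f2 q w) \<in> tangent_space A q"
    using tangent_map_in_tangent_space[OF f p v] inv[OF q] by simp
  ultimately show ?thesis by (intro tangent_eqI[OF _ w c])
qed

end

section \<open>Integral curves of a locally Lipschitz vector field\<close>

text \<open>The flow is constructed for an arbitrary locally Lipschitz vector field; only the
  continuation criterion of \<open>integral_curve_global_existence\<close> has to be checked for the gradient.\<close>

locale manifold_vector_field = hilbert_manifold M A
  for M :: "'a topology" and A :: "('a, 'h::{real_inner, complete_space}) chart set" +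
  fixes X :: "'a \<Rightarrow> ('a, 'h) tangent"
  assumes X_tangent: "p \<in> topspace M \<Longrightarrow> X p \<in> tangent_space A p"
    and X_lipschitz: "c \<in> A \<Longrightarrow> locally_lipschitz_on (chart_map c ` chart_dom c) (\<lambda>x. X (chart_inv c x) c)"
begin

definition integral_curve :: "real set \<Rightarrow> (real \<Rightarrow> 'a) \<Rightarrow> bool" where
  "integral_curve I \<xi> \<longleftrightarrow>
    continuous_map (top_of_set I) M \<xi> \<and>
    (\<forall>t\<in>I. \<forall>d\<in>A. \<xi> t \<in> chart_dom d \<longrightarrow>
      ((chart_map d \<circ> \<xi>) has_vector_derivative X (\<xi> t) d) (at t within I))"

lemma integral_curve_continuous: "integral_curve I \<xi> \<Longrightarrow> continuous_map (top_of_set I) M \<xi>"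
  by (simp add: integral_curve_def)

lemma integral_curve_limitin:
  assumes "integral_curve I \<xi>" "t \<in> I" shows "limitin M \<xi> (\<xi> t) (at t within I)"
  using iffD1[OF continuous_map_top_of_set_iff_limitin integral_curve_continuous[OF assms(1)]] assms(2)
  by (rule bspec)

lemma integral_curve_topspace: "integral_curve I \<xi> \<Longrightarrow> t \<in> I \<Longrightarrow> \<xi> t \<in> topspace M"
  by (rule limitin_topspace[OF integral_curve_limitin])

lemma integral_curve_derivative:
  "integral_curve I \<xi> \<Longrightarrow> t \<in> I \<Longrightarrow> d \<in> A \<Longrightarrow> \<xi> t \<in> chart_dom d \<Longrightarrow>
    ((chart_map d \<circ> \<xi>) has_vector_derivative X (\<xi> t) d) (at t within I)"
  by (simp add: integral_curve_def)

text \<open>A tangent vector is determined by its value in one chart, and so is the velocity of a curve.\<close>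

lemma integral_curveI_one_chart:
  assumes cont: "continuous_map (top_of_set I) M \<xi>"
    and der: "\<And>t. t \<in> I \<Longrightarrow> \<exists>c\<in>A. \<xi> t \<in> chart_dom c \<and>
      ((chart_map c \<circ> \<xi>) has_vector_derivative X (\<xi> t) c) (at t within I)"
  shows "integral_curve I \<xi>"
  unfolding integral_curve_def
proof (intro conjI ballI impI cont)
  fix t d assume t: "t \<in> I" and d: "d \<in> A" "\<xi> t \<in> chart_dom d"
  obtain c where c: "c \<in> A" "\<xi> t \<in> chart_dom c"
    "((chart_map c \<circ> \<xi>) has_vector_derivative X (\<xi> t) c) (at t within I)"
    using der[OF t] by blast
  have "X (\<xi> t) d = chart_change c d (\<xi> t) (X (\<xi> t) c)"
    by (rule tangent_change[OF X_tangent[OF chart_dom_topspace[OF d]] c(1) d(1) c(2) d(2)])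
  then show "((chart_map d \<circ> \<xi>) has_vector_derivative X (\<xi> t) d) (at t within I)"
    using curve_derivative_chart[OF cont t c(1,2) d c(3)] by simp
qed

lemma integral_curve_subset:
  assumes "integral_curve I \<xi>" "J \<subseteq> I" shows "integral_curve J \<xi>"
  unfolding integral_curve_def
proof (intro conjI ballI impI)
  show "continuous_map (top_of_set J) M \<xi>"
    using continuous_map_from_subtopology_mono[OF integral_curve_continuous[OF assms(1)] assms(2)] .
  fix t d assume "t \<in> J" "d \<in> A" "\<xi> t \<in> chart_dom d"
  then show "((chart_map d \<circ> \<xi>) has_vector_derivative X (\<xi> t) d) (at t within J)"
    using has_vector_derivative_within_subset[OF integral_curve_derivative[OF assms(1)] assms(2)] assms(2)
    by (simp add: subset_eq)
qed

lemma integral_curve_cong: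
  assumes "integral_curve I \<xi>" and eq: "\<And>t. t \<in> I \<Longrightarrow> \<xi> t = \<eta> t" shows "integral_curve I \<eta>"
  unfolding integral_curve_def
proof (intro conjI ballI impI)
  show "continuous_map (top_of_set I) M \<eta>"
    by (rule continuous_map_eq[OF integral_curve_continuous[OF assms(1)]]) (simp add: eq)
  fix t d assume t: "t \<in> I" and d: "d \<in> A" "\<eta> t \<in> chart_dom d"
  have "((chart_map d \<circ> \<xi>) has_vector_derivative X (\<eta> t) d) (at t within I)"
    using integral_curve_derivative[OF assms(1) t d(1)] d(2) eq[OF t] by simp
  then show "((chart_map d \<circ> \<eta>) has_vector_derivative X (\<eta> t) d) (at t within I)"
    by (rule has_vector_derivative_transform[rotated 2]) (simp_all add: t eq)
qed

text \<open>Being an integral curve is a local property in the time variable, which permits a global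
  solution to be pieced together from solutions on compact intervals.\<close>

lemma integral_curve_locally:
  assumes loc: "\<And>t. t \<in> I \<Longrightarrow> \<exists>U. open U \<and> t \<in> U \<and> integral_curve (I \<inter> U) \<xi>"
  shows "integral_curve I \<xi>"
  unfolding integral_curve_def
proof (intro conjI ballI impI)
  show "continuous_map (top_of_set I) M \<xi>"
  proof (rule continuous_map_top_of_set_locally)
    fix t assume "t \<in> I"
    from loc[OF this] show "\<exists>U. open U \<and> t \<in> U \<and> continuous_map (top_of_set (I \<inter> U)) M \<xi>"
      by (auto simp: integral_curve_continuous)
  qed
  fix t d assume t: "t \<in> I" and d: "d \<in> A" "\<xi> t \<in> chart_dom d"
  obtain U where U: "open U" "t \<in> U" "integral_curve (I \<inter> U) \<xi>" using loc[OF t] by blast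
  have "at t within I = at t within (I \<inter> U)"
    by (rule at_within_nhd[of t U]) (use U in auto)
  then show "((chart_map d \<circ> \<xi>) has_vector_derivative X (\<xi> t) d) (at t within I)"
    using integral_curve_derivative[OF U(3) _ d] t U(2) by simp
qed

lemma integral_curve_shift:
  assumes \<xi>: "integral_curve I \<xi>" and J: "\<And>t. t \<in> J \<Longrightarrow> t + a \<in> I"
  shows "integral_curve J (\<lambda>t. \<xi> (t + a))"
  unfolding integral_curve_def
proof (intro conjI ballI impI)
  have "continuous_map (top_of_set J) (top_of_set I) (\<lambda>t. t + a)"
    using J by (auto simp: image_subset_iff intro!: continuous_intros)
  from continuous_map_compose[OF this integral_curve_continuous[OF \<xi>]]
  show "continuous_map (top_of_set J) M (\<lambda>t. \<xi> (t + a))" by (simp add: o_def)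
  fix t d assume t: "t \<in> J" and d: "d \<in> A" "\<xi> (t + a) \<in> chart_dom d"
  have 1: "((\<lambda>t. t + a) has_vector_derivative 1) (at t within J)"
    by (auto intro!: derivative_eq_intros)
  have 2: "((chart_map d \<circ> \<xi>) has_vector_derivative X (\<xi> (t + a)) d) (at (t + a) within (\<lambda>t. t + a) ` J)"
    by (rule has_vector_derivative_within_subset[OF integral_curve_derivative[OF \<xi> J[OF t] d]]) (use J in auto)
  show "((chart_map d \<circ> (\<lambda>t. \<xi> (t + a))) has_vector_derivative X (\<xi> (t + a)) d) (at t within J)"
    using vector_diff_chain_within[OF 1 2] by (simp add: o_def)
qed

text \<open>For a short time both curves stay in one chart and in a ball on which the field is Lipschitz, so
  that Gronwall's argument applies to their coordinates.\<close>

lemma local_uniqueness: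
  assumes \<xi>: "integral_curve {a..b} \<xi>" and \<eta>: "integral_curve {a..b} \<eta>"
    and eq: "\<xi> a = \<eta> a" and ab: "a < b"
  shows "\<exists>\<delta>>0. a + \<delta> \<le> b \<and> (\<forall>t\<in>{a..a + \<delta>}. \<xi> t = \<eta> t)"
proof -
  have a: "a \<in> {a..b}" using ab by simp
  obtain c where c: "c \<in> A" "\<xi> a \<in> chart_dom c"
    using chart_exists[OF integral_curve_topspace[OF \<xi> a]] by blast
  let ?F = "\<lambda>x. X (chart_inv c x) c" and ?x = "chart_map c (\<xi> a)"
  have "?x \<in> chart_map c ` chart_dom c" using c(2) by (rule imageI)
  then obtain r L where r: "r > 0" "L-lipschitz_on (ball ?x r \<inter> chart_map c ` chart_dom c) ?F"
    using X_lipschitz[OF c(1)] unfolding locally_lipschitz_on_def by blast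
  define W where "W = {q \<in> chart_dom c. chart_map c q \<in> ball ?x r}"
  have W: "openin M W" "\<xi> a \<in> W" "\<eta> a \<in> W"
    using openin_chart_preimage[OF c(1) open_ball] r(1) c(2) eq by (auto simp: W_def)
  have "\<forall>\<^sub>F s in at a within {a..b}. \<xi> s \<in> W \<and> \<eta> s \<in> W"
    using integral_curve_limitin[OF \<xi> a] integral_curve_limitin[OF \<eta> a] W
    by (simp add: limitin_def eventually_conj)
  then obtain e where e: "e > 0" "\<And>s. s \<in> {a..b} \<Longrightarrow> s \<noteq> a \<Longrightarrow> dist s a < e \<Longrightarrow> \<xi> s \<in> W \<and> \<eta> s \<in> W"
    unfolding eventually_at by blast
  define \<delta> where "\<delta> = min (e / 2) (b - a)"
  have \<delta>: "\<delta> > 0" "a + \<delta> \<le> b" "\<delta> < e" using e(1) ab by (auto simp: \<delta>_def)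
  have inW: "\<xi> s \<in> W \<and> \<eta> s \<in> W" if "s \<in> {a..a + \<delta>}" for s
    using e(2)[of s] that \<delta> W by (cases "s = a") (auto simp: dist_real_def)
  have der: "((chart_map c \<circ> \<zeta>) has_vector_derivative ?F ((chart_map c \<circ> \<zeta>) s)) (at s within {a..a + \<delta>})"
    if \<zeta>: "integral_curve {a..b} \<zeta>" and s: "s \<in> {a..a + \<delta>}" and "\<zeta> s \<in> W" for \<zeta> s
  proof -
    have dom: "\<zeta> s \<in> chart_dom c" using that(3) by (simp add: W_def)
    have "((chart_map c \<circ> \<zeta>) has_vector_derivative X (\<zeta> s) c) (at s within {a..a + \<delta>})"
      by (rule has_vector_derivative_within_subset[OF integral_curve_derivative[OF \<zeta> _ c(1) dom]])
        (use s \<delta> in auto)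
    then show ?thesis by (simp add: chart_inv_map[OF c(1) dom])
  qed
  have "\<xi> t = \<eta> t" if t: "t \<in> {a..a + \<delta>}" for t
  proof -
    have "(chart_map c \<circ> \<xi>) t = (chart_map c \<circ> \<eta>) t"
    proof (rule lipschitz_ode_unique[OF r(2), where a = a and b = "a + \<delta>"])
      show "(chart_map c \<circ> \<xi>) s \<in> ball ?x r \<inter> chart_map c ` chart_dom c \<and>
          (chart_map c \<circ> \<eta>) s \<in> ball ?x r \<inter> chart_map c ` chart_dom c"
        if "s \<in> {a..a + \<delta>}" for s
        using inW[OF that] by (simp add: W_def)
      show "((chart_map c \<circ> \<xi>) has_vector_derivative ?F ((chart_map c \<circ> \<xi>) s)) (at s within {a..a + \<delta>})"
        if "s \<in> {a..a + \<delta>}" for s using der[OF \<xi> that] inW[OF that] by blast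
      show "((chart_map c \<circ> \<eta>) has_vector_derivative ?F ((chart_map c \<circ> \<eta>) s)) (at s within {a..a + \<delta>})"
        if "s \<in> {a..a + \<delta>}" for s using der[OF \<eta> that] inW[OF that] by blast
      show "(chart_map c \<circ> \<xi>) a = (chart_map c \<circ> \<eta>) a" by (simp add: eq)
      show "t \<in> {a..a + \<delta>}" by (rule t)
    qed
    then show ?thesis
      using inW[OF t] inj_onD[OF inj_on_chart[OF c(1)], of "\<xi> t" "\<eta> t"] by (simp add: W_def)
  qed
  then show ?thesis using \<delta> by blast
qed

text \<open>At the last time up to which the curves agree, local uniqueness extends the agreement. Such a time
  exists because the set where two continuous curves agree is closed in a Hausdorff space.\<close>

lemma integral_curve_unique:
  assumes \<xi>: "integral_curve {a..b} \<xi>" and \<eta>: "integral_curve {a..b} \<eta>"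
    and eq: "\<xi> a = \<eta> a" and t: "t \<in> {a..b}"
  shows "\<xi> t = \<eta> t"
proof (rule ccontr)
  assume neq: "\<xi> t \<noteq> \<eta> t"
  define Z where "Z = {s \<in> {a..b}. \<xi> s = \<eta> s} \<inter> {a..t}"
  have "closedin (top_of_set {a..b}) {s \<in> {a..b}. \<xi> s = \<eta> s}"
    using closedin_continuous_maps_eq[OF Hausdorff integral_curve_continuous[OF \<xi>] integral_curve_continuous[OF \<eta>]]
    by simp
  then have "closed {s \<in> {a..b}. \<xi> s = \<eta> s}" by (rule closedin_closed_trans) simp
  then have closed: "closed Z" unfolding Z_def by (intro closed_Int) auto
  have bdd: "bdd_above Z" unfolding Z_def by (rule bdd_aboveI[of _ t]) auto
  have "a \<in> Z" using eq t by (simp add: Z_def)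
  then have ne: "Z \<noteq> {}" by blast
  define s where "s = Sup Z"
  have s: "s \<in> Z" unfolding s_def by (rule closed_contains_Sup[OF ne bdd closed])
  then have st: "s < t" "a \<le> s" "\<xi> s = \<eta> s" using neq by (auto simp: Z_def less_le)
  have "integral_curve {s..t} \<xi>" "integral_curve {s..t} \<eta>"
    by (rule integral_curve_subset[OF \<xi>], use st t in simp, rule integral_curve_subset[OF \<eta>], use st t in simp)
  from local_uniqueness[OF this st(3,1)] obtain \<delta> where \<delta>: "\<delta> > 0" "s + \<delta> \<le> t" "\<xi> (s + \<delta>) = \<eta> (s + \<delta>)"
    by force
  then have "s + \<delta> \<in> Z" using st t by (simp add: Z_def)
  then have "s + \<delta> \<le> s" unfolding s_def using cSup_upper[OF _ bdd] by blast
  then show False using \<delta>(1) by simp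
qed

text \<open>The constants in the Picard-Lindelof theorem depend only on bounds in a ball around \<open>y\<close>, so that
  one time of existence serves for all initial points near \<open>y\<close>. This uniformity
  is what allows a solution to be continued past a time at which it merely accumulates.\<close>

lemma uniform_local_existence:
  assumes y: "y \<in> topspace M"
  obtains U r where "openin M U" "y \<in> U" "r > 0"
    "\<And>p. p \<in> U \<Longrightarrow> \<exists>\<eta>. integral_curve {0..r} \<eta> \<and> \<eta> 0 = p"
proof -
  obtain c where c: "c \<in> A" "y \<in> chart_dom c" using chart_exists[OF y] by blast
  let ?F = "\<lambda>x. X (chart_inv c x) c" and ?x = "chart_map c y" and ?V = "chart_map c ` chart_dom c"
  have x: "?x \<in> ?V" using c(2) by (rule imageI)
  then obtain r0 L where r0: "r0 > 0" "L-lipschitz_on (ball ?x r0 \<inter> ?V) ?F"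
    using X_lipschitz[OF c(1)] unfolding locally_lipschitz_on_def by blast
  obtain r1 where r1: "r1 > 0" "ball ?x r1 \<subseteq> ?V"
    using open_chart_image[OF c(1)] x open_contains_ball by blast
  define \<rho> where "\<rho> = min r0 r1"
  have \<rho>: "\<rho> > 0" "ball ?x \<rho> \<subseteq> ?V" using r0 r1 by (auto simp: \<rho>_def)
  have lip: "L-lipschitz_on (ball ?x \<rho>) ?F"
    by (rule lipschitz_on_subset[OF r0(2)]) (use \<rho> in \<open>auto simp: \<rho>_def\<close>)
  have L: "L \<ge> 0" using lip lipschitz_on_nonneg by blast
  define K where "K = norm (?F ?x) + L * \<rho>"
  have K0: "K \<ge> 0" using L \<rho>(1) by (simp add: K_def)
  have K: "norm (?F z) \<le> K" if z: "z \<in> ball ?x \<rho>" for z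
  proof -
    have "norm (?F z - ?F ?x) \<le> L * dist z ?x"
      using lipschitz_onD[OF lip z, of ?x] \<rho>(1) by (simp add: dist_norm)
    also have "\<dots> \<le> L * \<rho>" using z L by (intro mult_left_mono) (auto simp: dist_commute)
    finally show ?thesis using norm_triangle_sub[of "?F z" "?F ?x"] by (simp add: K_def)
  qed
  \<comment> \<open>Balls of radius \<open>R\<close> around points of the ball of radius \<open>R\<close> stay within the ball of radius \<open>\<rho>\<close>, where the bounds hold.\<close>
  define R where "R = \<rho> / 3"
  define r where "r = min (R / (K + 1)) (1 / (2 * (L + 1)))"
  have R: "R > 0" using \<rho> by (simp add: R_def)
  have r: "r > 0" using R K0 L by (simp add: r_def)
  have rK: "r * K \<le> R"
  proof -
    have "r * K \<le> R / (K + 1) * K" using K0 by (intro mult_right_mono) (auto simp: r_def)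
    also have "\<dots> \<le> R" using K0 R by (simp add: field_simps)
    finally show ?thesis .
  qed
  have rL: "r * L < 1"
  proof -
    have "r * L \<le> 1 / (2 * (L + 1)) * L" using L by (intro mult_right_mono) (auto simp: r_def)
    also have "\<dots> < 1" using L by (simp add: field_simps)
    finally show ?thesis .
  qed
  define U where "U = {q \<in> chart_dom c. chart_map c q \<in> ball ?x R}"
  show ?thesis
  proof (rule that[of U r])
    show "openin M U" unfolding U_def by (rule openin_chart_preimage[OF c(1) open_ball])
    show "y \<in> U" using c(2) R by (simp add: U_def)
    show "r > 0" by (rule r)
    fix p assume p: "p \<in> U"
    have dom: "p \<in> chart_dom c" using p by (simp add: U_def)
    have sub: "cball (chart_map c p) R \<subseteq> ball ?x \<rho>"
    proof
      fix z assume "z \<in> cball (chart_map c p) R"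
      then have "dist ?x z < R + R" using p dist_triangle[of ?x z "chart_map c p"] by (auto simp: U_def)
      then show "z \<in> ball ?x \<rho>" using R by (simp add: R_def)
    qed
    obtain u where u: "u 0 = chart_map c p" "\<And>t. t \<in> {0..r} \<Longrightarrow> u t \<in> cball (chart_map c p) R"
      "\<And>t. t \<in> {0..r} \<Longrightarrow> (u has_vector_derivative ?F (u t)) (at t within {0..r})"
      by (rule picard_lindelof_hilbert[OF lipschitz_on_subset[OF lip sub], of K r])
        (use K sub r rK rL R in auto)
    have uV: "u t \<in> ?V" if "t \<in> {0..r}" for t using u(2)[OF that] sub \<rho>(2) by blast
    have "integral_curve {0..r} (\<lambda>t. chart_inv c (u t))"
    proof (rule integral_curveI_one_chart)
      show "continuous_map (top_of_set {0..r}) M (\<lambda>t. chart_inv c (u t))"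
        unfolding continuous_map_top_of_set_iff_limitin
      proof
        fix t assume t: "t \<in> {0..r}"
        have "(u \<longlongrightarrow> u t) (at t within {0..r})"
          using has_vector_derivative_continuous[OF u(3)[OF t]] by (simp add: continuous_within)
        then show "limitin M (\<lambda>t. chart_inv c (u t)) (chart_inv c (u t)) (at t within {0..r})"
          by (rule limitin_chart_inv[OF _ c(1) uV[OF t]])
      qed
      fix t assume t: "t \<in> {0..r}"
      have "((chart_map c \<circ> (\<lambda>t. chart_inv c (u t))) has_vector_derivative ?F (u t)) (at t within {0..r})"
        by (rule has_vector_derivative_transform[OF t _ u(3)[OF t]]) (simp add: chart_map_inv[OF uV])
      then show "\<exists>c'\<in>A. chart_inv c (u t) \<in> chart_dom c' \<and>
          ((chart_map c' \<circ> (\<lambda>t. chart_inv c (u t))) has_vector_derivative X (chart_inv c (u t)) c') (at t within {0..r})"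
        using c(1) chart_inv_in_dom[OF uV[OF t]] by blast
    qed
    moreover have "chart_inv c (u 0) = p" by (simp add: u(1) chart_inv_map[OF c(1) dom])
    ultimately show "\<exists>\<eta>. integral_curve {0..r} \<eta> \<and> \<eta> 0 = p" by blast
  qed
qed

text \<open>At the junction both one-sided derivatives equal the vector field, so the derivative within the
  union of the two intervals exists.\<close>

lemma integral_curve_concat:
  assumes \<xi>: "integral_curve {0..a} \<xi>" and \<eta>: "integral_curve {0..b} \<eta>" and eq: "\<eta> 0 = \<xi> a"
    and ab: "0 \<le> a" "0 \<le> b"
  shows "integral_curve {0..a + b} (\<lambda>t. if t \<in> {0..a} then \<xi> t else \<eta> (t - a))"
    (is "integral_curve _ ?\<zeta>")
proof -
  have sh: "integral_curve {a..a + b} (\<lambda>t. \<eta> (t - a))"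
    using integral_curve_shift[OF \<eta>, of "{a..a + b}" "- a"] by simp
  have 1: "integral_curve {0..a} ?\<zeta>" by (rule integral_curve_cong[OF \<xi>]) simp
  have 2: "integral_curve {a..a + b} ?\<zeta>" by (rule integral_curve_cong[OF sh]) (use eq in auto)
  have un: "{0..a + b} = {0..a} \<union> {a..a + b}" using ab by auto
  \<comment> \<open>Away from a closed interval the filter within it is trivial, so each piece may be treated at all times.\<close>
  have lim: "limitin M ?\<zeta> (?\<zeta> t) (at t within J)" if "integral_curve J ?\<zeta>" "closed J" "?\<zeta> t \<in> topspace M" for t J
  proof (cases "t \<in> J")
    case False
    then have "at t within J = bot" using that(2) by (simp add: trivial_limit_within closed_limpt) (metis closed_limpt)
    then show ?thesis using that(3) by (simp add: limitin_def)
  qed (use integral_curve_limitin[OF that(1)] in blast)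
  have der: "((chart_map d \<circ> ?\<zeta>) has_vector_derivative X (?\<zeta> t) d) (at t within J)"
    if "integral_curve J ?\<zeta>" "closed J" "d \<in> A" "?\<zeta> t \<in> chart_dom d" for t J d
  proof (cases "t \<in> J")
    case False
    then have "at t within J = bot" using that(2) by (simp add: trivial_limit_within closed_limpt) (metis closed_limpt)
    then show ?thesis by (simp add: has_vector_derivative_def has_derivative_def bounded_linear_scaleR_left)
  qed (use integral_curve_derivative[OF that(1) _ that(3,4)] in blast)
  have top: "?\<zeta> t \<in> topspace M" if "t \<in> {0..a + b}" for t
    using integral_curve_topspace[OF 1, of t] integral_curve_topspace[OF 2, of t] that unfolding un by blast
  show ?thesis unfolding integral_curve_def
  proof (intro conjI ballI impI)
    show "continuous_map (top_of_set {0..a + b}) M ?\<zeta>"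
      unfolding continuous_map_top_of_set_iff_limitin
    proof
      fix t assume t: "t \<in> {0..a + b}"
      have "limitin M ?\<zeta> (?\<zeta> t) (at t within {0..a})" "limitin M ?\<zeta> (?\<zeta> t) (at t within {a..a + b})"
        by (rule lim[OF 1 _ top[OF t]], simp, rule lim[OF 2 _ top[OF t]], simp)
      then show "limitin M ?\<zeta> (?\<zeta> t) (at t within {0..a + b})"
        unfolding un at_within_union limitin_def eventually_sup by blast
    qed
    fix t d assume t: "t \<in> {0..a + b}" and d: "d \<in> A" "?\<zeta> t \<in> chart_dom d"
    have "((chart_map d \<circ> ?\<zeta>) has_vector_derivative X (?\<zeta> t) d) (at t within {0..a})"
      "((chart_map d \<circ> ?\<zeta>) has_vector_derivative X (?\<zeta> t) d) (at t within {a..a + b})"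
      by (rule der[OF 1 _ d], simp, rule der[OF 2 _ d], simp)
    then show "((chart_map d \<circ> ?\<zeta>) has_vector_derivative X (?\<zeta> t) d) (at t within {0..a + b})"
      unfolding un by (rule has_vector_derivative_within_Un)
  qed
qed

text \<open>The continuation argument: if the existence times had a finite supremum \<open>T\<close>, the solution on
  \<open>[0,T)\<close> would come close to a point \<open>y\<close> at times arbitrarily near \<open>T\<close>, and the uniform existence
  time near \<open>y\<close> would carry it beyond \<open>T\<close>.\<close>

lemma integral_curve_global_existence:
  assumes x: "x \<in> topspace M"
    and continuation: "\<And>T \<xi>. T > 0 \<Longrightarrow> integral_curve {0..<T} \<xi> \<Longrightarrow>
      \<exists>s y. (\<forall>k::nat. s k \<in> {0..<T}) \<and> s \<longlonglongrightarrow> T \<and> limitin M (\<lambda>k. \<xi> (s k)) y sequentially"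
  obtains \<xi> where "integral_curve {0..} \<xi>" "\<xi> 0 = x"
proof -
  \<comment> \<open>By uniqueness the choices for different \<open>T\<close> are compatible; \<open>\<xi>\<close> is their union.\<close>
  define sol where "sol T = (SOME \<xi>. integral_curve {0..T} \<xi> \<and> \<xi> 0 = x)" for T
  define S where "S = {T. T > 0 \<and> (\<exists>\<xi>. integral_curve {0..T} \<xi> \<and> \<xi> 0 = x)}"
  define \<xi> where "\<xi> t = (if t > 0 then sol t t else x)" for t
  have sol: "integral_curve {0..T} (sol T) \<and> sol T 0 = x" if "T \<in> S" for T
  proof -
    have "\<exists>\<xi>. integral_curve {0..T} \<xi> \<and> \<xi> 0 = x" using that by (simp add: S_def)
    then show ?thesis unfolding sol_def by (rule someI_ex)
  qed
  have agree: "\<xi> t = sol T t" if T: "T \<in> S" and t: "t \<in> {0..T}" for t T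
  proof (cases "t = 0")
    case False
    have sub: "integral_curve {0..t} (sol T)"
      by (rule integral_curve_subset[OF conjunct1[OF sol[OF T]]]) (use t in auto)
    have tS: "t \<in> S" unfolding S_def
    proof (intro CollectI conjI exI)
      show "t > 0" using False t by simp
      show "integral_curve {0..t} (sol T)" by (rule sub)
      show "sol T 0 = x" using sol[OF T] by (rule conjunct2)
    qed
    have "sol t 0 = sol T 0" by (simp only: conjunct2[OF sol[OF T]] conjunct2[OF sol[OF tS]])
    then have "sol t t = sol T t"
      by (rule integral_curve_unique[OF conjunct1[OF sol[OF tS]] sub]) (use t in simp)
    then show ?thesis using False t by (simp add: \<xi>_def)
  qed (simp add: \<xi>_def conjunct2[OF sol[OF T]])
  have curve: "integral_curve I \<xi>" if I: "\<And>t. t \<in> I \<Longrightarrow> 0 \<le> t \<and> (\<exists>T\<in>S. t < T)" for I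
  proof (rule integral_curve_locally)
    fix t assume t: "t \<in> I"
    obtain T where T: "T \<in> S" "t < T" using I[OF t] by blast
    have "I \<inter> {..<T} \<subseteq> {0..T}" using I by auto
    then have "integral_curve (I \<inter> {..<T}) (sol T)"
      by (rule integral_curve_subset[OF conjunct1[OF sol[OF T(1)]]])
    then have "integral_curve (I \<inter> {..<T}) \<xi>"
      by (rule integral_curve_cong) (use agree[OF T(1)] I in auto)
    then show "\<exists>U. open U \<and> t \<in> U \<and> integral_curve (I \<inter> U) \<xi>"
      using T(2) by (intro exI[of _ "{..<T}"]) auto
  qed
  obtain U r where U: "x \<in> U" "r > 0" "\<And>p. p \<in> U \<Longrightarrow> \<exists>\<eta>. integral_curve {0..r} \<eta> \<and> \<eta> 0 = p"
    using uniform_local_existence[OF x] by metis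
  then have rS: "r \<in> S" by (simp add: S_def)
  have "\<not> bdd_above S"
  proof
    assume bdd: "bdd_above S"
    define T where "T = Sup S"
    have "r \<le> T" unfolding T_def by (rule cSup_upper[OF rS bdd])
    then have T: "T > 0" using U(2) by simp
    have "integral_curve {0..<T} \<xi>"
    proof (rule curve)
      fix t assume "t \<in> {0..<T}"
      then show "0 \<le> t \<and> (\<exists>T\<in>S. t < T)"
        using less_cSup_iff[of S t] rS bdd by (auto simp: T_def)
    qed
    from continuation[OF T this] obtain s y where s: "\<And>k::nat. s k \<in> {0..<T}" "s \<longlonglongrightarrow> T"
      "limitin M (\<lambda>k. \<xi> (s k)) y sequentially" by blast
    have y: "y \<in> topspace M" by (rule limitin_topspace[OF s(3)])
    obtain V \<rho> where V: "openin M V" "y \<in> V" "\<rho> > 0"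
      "\<And>p. p \<in> V \<Longrightarrow> \<exists>\<eta>. integral_curve {0..\<rho>} \<eta> \<and> \<eta> 0 = p"
      using uniform_local_existence[OF y] by metis
    have "\<forall>\<^sub>F k in sequentially. \<xi> (s k) \<in> V" using s(3) V by (simp add: limitin_def)
    moreover have "\<forall>\<^sub>F k in sequentially. s k > max 0 (T - \<rho>)"
      by (rule order_tendstoD(1)[OF s(2)]) (use T V(3) in simp)
    ultimately have "\<forall>\<^sub>F k in sequentially. \<xi> (s k) \<in> V \<and> s k > max 0 (T - \<rho>)" by (rule eventually_conj)
    then obtain k where k: "\<xi> (s k) \<in> V" "s k > 0" "s k + \<rho> > T"
      by (auto simp: eventually_sequentially)
    obtain T' where T': "T' \<in> S" "s k < T'"
      using less_cSup_iff[of S "s k"] rS bdd s(1)[of k] by (auto simp: T_def)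
    obtain \<eta> where \<eta>: "integral_curve {0..\<rho>} \<eta>" "\<eta> 0 = \<xi> (s k)" using V(4)[OF k(1)] by blast
    have "integral_curve {0..s k} (sol T')"
      by (rule integral_curve_subset[OF conjunct1[OF sol[OF T'(1)]]]) (use T' in auto)
    moreover have "\<eta> 0 = sol T' (s k)" using \<eta>(2) agree[OF T'(1), of "s k"] T' k(2) by simp
    ultimately have "integral_curve {0..s k + \<rho>} (\<lambda>t. if t \<in> {0..s k} then sol T' t else \<eta> (t - s k))"
      using \<eta>(1) k(2) V(3) by (intro integral_curve_concat) auto
    moreover have "(if 0 \<in> {0..s k} then sol T' 0 else \<eta> (0 - s k)) = x"
      using k(2) conjunct2[OF sol[OF T'(1)]] by simp
    ultimately have "s k + \<rho> \<in> S" unfolding S_def using k V(3) T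
      by (intro CollectI conjI exI[of _ "\<lambda>t. if t \<in> {0..s k} then sol T' t else \<eta> (t - s k)"]) simp_all
    then have "s k + \<rho> \<le> T" unfolding T_def using cSup_upper[OF _ bdd] by blast
    then show False using k(3) by simp
  qed
  then have "\<exists>T\<in>S. t < T" for t unfolding bdd_above_def by (meson not_le)
  then have "integral_curve {0..} \<xi>" by (intro curve) auto
  then show ?thesis by (rule that) (simp add: \<xi>_def)
qed

lemma tendsto_vector_field:
  assumes "limitin M f p F" "c \<in> A" "p \<in> chart_dom c"
  shows "((\<lambda>s. X (f s) c) \<longlongrightarrow> X p c) F"
proof -
  let ?F = "\<lambda>x. X (chart_inv c x) c"
  have "continuous_on (chart_map c ` chart_dom c) ?F"
    by (rule locally_lipschitz_on_imp_continuous_on[OF X_lipschitz[OF assms(2)] open_chart_image[OF assms(2)]])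
  then have "isCont ?F (chart_map c p)"
    using open_chart_image[OF assms(2)] assms(3) by (simp add: continuous_on_eq_continuous_at)
  then have "((\<lambda>s. ?F (chart_map c (f s))) \<longlongrightarrow> ?F (chart_map c p)) F"
    using limitin_chart(2)[OF assms] by (rule isCont_tendsto_compose)
  then have lim: "((\<lambda>s. ?F (chart_map c (f s))) \<longlongrightarrow> X p c) F"
    by (simp add: chart_inv_map[OF assms(2,3)])
  have "\<forall>\<^sub>F s in F. ?F (chart_map c (f s)) = X (f s) c"
    using limitin_chart(1)[OF assms] by eventually_elim (simp add: chart_inv_map[OF assms(2)])
  then show ?thesis by (rule Lim_transform_eventually[OF lim])
qed

text \<open>Affine reparametrisation, with velocity scaled by \<open>k\<close>. It turns a piece of an integral curve,
  traversed in either direction, into a competitor on \<open>[0,1]\<close> for the path metric.\<close>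

lemma integral_curve_affine:
  assumes \<xi>: "integral_curve I \<xi>" and J: "\<And>r. r \<in> J \<Longrightarrow> a + r * k \<in> I"
  defines "\<gamma> \<equiv> (\<lambda>r. \<xi> (a + r * k))"
  shows "C1_curve M A J \<gamma>"
    and "\<And>r d. r \<in> J \<Longrightarrow> d \<in> A \<Longrightarrow> \<gamma> r \<in> chart_dom d \<Longrightarrow>
      ((chart_map d \<circ> \<gamma>) has_vector_derivative k *\<^sub>R X (\<gamma> r) d) (at r within J)"
proof -
  have "continuous_map (top_of_set J) (top_of_set I) (\<lambda>r. a + r * k)"
    using J by (auto simp: image_subset_iff intro!: continuous_intros)
  from continuous_map_compose[OF this integral_curve_continuous[OF \<xi>]]
  have cont: "continuous_map (top_of_set J) M \<gamma>" by (simp add: o_def \<gamma>_def)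
  show der: "((chart_map d \<circ> \<gamma>) has_vector_derivative k *\<^sub>R X (\<gamma> r) d) (at r within J)"
    if r: "r \<in> J" and d: "d \<in> A" "\<gamma> r \<in> chart_dom d" for r d
  proof -
    have 1: "((\<lambda>r. a + r * k) has_vector_derivative k) (at r within J)"
      by (auto intro!: derivative_eq_intros)
    have 2: "((chart_map d \<circ> \<xi>) has_vector_derivative X (\<gamma> r) d) (at (a + r * k) within (\<lambda>r. a + r * k) ` J)"
      unfolding \<gamma>_def
      by (rule has_vector_derivative_within_subset[OF integral_curve_derivative[OF \<xi> J[OF r] d(1)]])
        (use J d in \<open>auto simp: \<gamma>_def\<close>)
    show ?thesis using vector_diff_chain_within[OF 1 2] by (simp add: o_def \<gamma>_def)
  qed
  show "C1_curve M A J \<gamma>"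
    unfolding C1_curve_def
  proof (intro conjI ballI exI cont)
    fix d assume d: "d \<in> A"
    show "continuous_on {t \<in> J. \<gamma> t \<in> chart_dom d} (\<lambda>r. k *\<^sub>R X (\<gamma> r) d)"
      unfolding continuous_on_def
    proof
      fix r assume r: "r \<in> {t \<in> J. \<gamma> t \<in> chart_dom d}"
      have "limitin M \<gamma> (\<gamma> r) (at r within J)"
        using cont r by (simp add: continuous_map_top_of_set_iff_limitin)
      then have "((\<lambda>s. k *\<^sub>R X (\<gamma> s) d) \<longlongrightarrow> k *\<^sub>R X (\<gamma> r) d) (at r within J)"
        by (intro tendsto_scaleR tendsto_const tendsto_vector_field[OF _ d]) (use r in simp_all)
      then show "((\<lambda>s. k *\<^sub>R X (\<gamma> s) d) \<longlongrightarrow> k *\<^sub>R X (\<gamma> r) d) (at r within {t \<in> J. \<gamma> t \<in> chart_dom d})"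
        by (rule tendsto_within_subset) auto
    qed
    fix r assume "r \<in> {t \<in> J. \<gamma> t \<in> chart_dom d}"
    then show "((chart_map d \<circ> \<gamma>) has_vector_derivative k *\<^sub>R X (\<gamma> r) d) (at r within J)"
      using der[of r d] d by simp
  qed
qed

lemma integral_curve_iff_C1_curve:
  assumes "\<And>t. t \<in> I \<Longrightarrow> at t within I \<noteq> bot"
  shows "integral_curve I \<xi> \<longleftrightarrow> C1_curve M A I \<xi> \<and> (\<forall>t\<in>I. velocity A I \<xi> t = X (\<xi> t))"
proof (intro iffI conjI ballI)
  assume \<xi>: "integral_curve I \<xi>"
  show "C1_curve M A I \<xi>" using integral_curve_affine(1)[OF \<xi>, of I 0 1] by simp
  fix t assume t: "t \<in> I"
  have top: "\<xi> t \<in> topspace M" by (rule integral_curve_topspace[OF \<xi> t])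
  show "velocity A I \<xi> t = X (\<xi> t)"
  proof
    fix d show "velocity A I \<xi> t d = X (\<xi> t) d"
    proof (cases "d \<in> A \<and> \<xi> t \<in> chart_dom d")
      case True
      then show ?thesis
        using vector_derivative_within[OF assms[OF t] integral_curve_derivative[OF \<xi> t]]
        by (simp add: velocity_def)
    next
      case False
      then have "X (\<xi> t) d = 0" using X_tangent[OF top] unfolding tangent_space_def by blast
      moreover have "velocity A I \<xi> t d = 0" unfolding velocity_def by (rule if_not_P[OF False])
      ultimately show ?thesis by simp
    qed
  qed
next
  assume *: "C1_curve M A I \<xi> \<and> (\<forall>t\<in>I. velocity A I \<xi> t = X (\<xi> t))"
  show "integral_curve I \<xi>"
    unfolding integral_curve_def
  proof (intro conjI ballI impI)
    show "continuous_map (top_of_set I) M \<xi>" using * by (simp add: C1_curve_def)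
    fix t d assume t: "t \<in> I" and d: "d \<in> A" "\<xi> t \<in> chart_dom d"
    obtain w where w: "((chart_map d \<circ> \<xi>) has_vector_derivative w) (at t within I)"
      using conjunct1[OF *] t d unfolding C1_curve_def by blast
    have "X (\<xi> t) d = velocity A I \<xi> t d" using * t by simp
    also have "\<dots> = w" unfolding velocity_def using vector_derivative_within[OF assms[OF t] w] d by simp
    finally show "((chart_map d \<circ> \<xi>) has_vector_derivative X (\<xi> t) d) (at t within I)" using w by simp
  qed
qed

lemma integral_curve_connected:
  assumes "integral_curve I \<xi>" "connected I" "a \<in> I" "b \<in> I"
  shows "\<xi> b \<in> connected_component_of_set M (\<xi> a)"
proof -
  have "connectedin M (\<xi> ` I)"
    by (rule connectedin_continuous_map_image[OF integral_curve_continuous[OF assms(1)]])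
      (use assms(2) in \<open>simp add: connectedin_subtopology\<close>)
  from connected_component_of_maximal[OF this imageI[OF assms(3)]] show ?thesis
    using assms(4) by blast
qed

end

section \<open>Riemannian metrics\<close>

locale riemannian_manifold = hilbert_manifold M A
  for M :: "'a topology" and A :: "('a, 'h::{real_inner, complete_space}) chart set" +
  fixes g :: "('a, 'h) metric_tensor"
  assumes metric: "riemannian_metric_C1 M A g"
begin

lemma inner_product: "p \<in> topspace M \<Longrightarrow> inner_product_on_tangent_space A p (g p)"
  using metric by (simp add: riemannian_metric_C1_def)

lemma metric_sym: "p \<in> topspace M \<Longrightarrow> u \<in> tangent_space A p \<Longrightarrow> v \<in> tangent_space A p \<Longrightarrow> g p u v = g p v u"
  using inner_product[of p] by (simp add: inner_product_on_tangent_space_def)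

lemma metric_scale:
  "p \<in> topspace M \<Longrightarrow> u \<in> tangent_space A p \<Longrightarrow> w \<in> tangent_space A p \<Longrightarrow>
    g p (\<lambda>c. r *\<^sub>R u c) w = r * g p u w"
  using inner_product[of p] by (simp add: inner_product_on_tangent_space_def)

lemma metric_add:
  "p \<in> topspace M \<Longrightarrow> u \<in> tangent_space A p \<Longrightarrow> v \<in> tangent_space A p \<Longrightarrow> w \<in> tangent_space A p \<Longrightarrow>
    g p (\<lambda>c. u c + v c) w = g p u w + g p v w"
  using inner_product[of p] by (simp add: inner_product_on_tangent_space_def)

lemma metric_combination:
  assumes p: "p \<in> topspace M"
    and u: "u \<in> tangent_space A p" and v: "v \<in> tangent_space A p" and w: "w \<in> tangent_space A p"
  shows "g p (\<lambda>c. a *\<^sub>R u c + b *\<^sub>R v c) w = a * g p u w + b * g p v w"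
proof -
  have "g p (\<lambda>c. (\<lambda>c. a *\<^sub>R u c) c + (\<lambda>c. b *\<^sub>R v c) c) w = g p (\<lambda>c. a *\<^sub>R u c) w + g p (\<lambda>c. b *\<^sub>R v c) w"
    by (rule metric_add[OF p tangent_scale[OF p u] tangent_scale[OF p v] w])
  then show ?thesis using metric_scale[OF p u w] metric_scale[OF p v w] by simp
qed

lemma metric_zero: "p \<in> topspace M \<Longrightarrow> w \<in> tangent_space A p \<Longrightarrow> g p (\<lambda>_. 0) w = 0"
  using metric_scale[of p w w 0] by simp

lemma metric_pos: "p \<in> topspace M \<Longrightarrow> u \<in> tangent_space A p \<Longrightarrow> u \<noteq> (\<lambda>_. 0) \<Longrightarrow> g p u u > 0"
  using inner_product[of p] by (simp add: inner_product_on_tangent_space_def)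

lemma metric_nonneg: "p \<in> topspace M \<Longrightarrow> u \<in> tangent_space A p \<Longrightarrow> g p u u \<ge> 0"
  using metric_pos[of p u] metric_zero[of p u] by (cases "u = (\<lambda>_. 0)") auto

lemma metric_eq_0: "p \<in> topspace M \<Longrightarrow> u \<in> tangent_space A p \<Longrightarrow> g p u u = 0 \<Longrightarrow> u = (\<lambda>_. 0)"
  using metric_pos[of p u] by fastforce

lemma metric_Cauchy_Schwarz:
  assumes p: "p \<in> topspace M" and u: "u \<in> tangent_space A p" and v: "v \<in> tangent_space A p"
  shows "\<bar>g p u v\<bar> \<le> metric_norm g p u * metric_norm g p v"
proof -
  have "(g p u v)\<^sup>2 \<le> g p u u * g p v v"
  proof (cases "v = (\<lambda>_. 0)")
    case True
    have "g p u v = 0" using metric_sym[OF p u v] metric_zero[OF p u] True by simp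
    then show ?thesis using metric_nonneg[OF p u] metric_nonneg[OF p v] by simp
  next
    case False
    then have pos: "g p v v > 0" by (rule metric_pos[OF p v])
    \<comment> \<open>The \<open>t\<close> that minimises \<open>g p (u + t v) (u + t v)\<close>.\<close>
    define t where "t = - (g p u v / g p v v)"
    define w where "w = (\<lambda>c. 1 *\<^sub>R u c + t *\<^sub>R v c)"
    have w: "w \<in> tangent_space A p" unfolding w_def by (rule tangent_combination[OF p u v])
    have "g p w x = g p u x + t * g p v x" if "x \<in> tangent_space A p" for x
      using metric_combination[OF p u v that, of 1 t] by (simp add: w_def)
    then have "g p w w = (g p u u + t * g p v u) + t * (g p u v + t * g p v v)"
      using metric_sym[OF p u w] metric_sym[OF p v w] u v w by simp
    also have "\<dots> = g p u u - (g p u v)\<^sup>2 / g p v v"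
      using metric_sym[OF p u v] pos by (simp add: t_def field_simps power2_eq_square)
    finally have "(g p u v)\<^sup>2 / g p v v \<le> g p u u" using metric_nonneg[OF p w] by simp
    then show ?thesis using pos by (simp add: field_simps)
  qed
  then have "sqrt ((g p u v)\<^sup>2) \<le> sqrt (g p u u * g p v v)" by (rule real_sqrt_le_mono)
  then show ?thesis by (simp add: metric_norm_def real_sqrt_mult)
qed

lemma metric_chart:
  assumes "c \<in> A"
  obtains B :: "'h \<Rightarrow> 'h \<Rightarrow>\<^sub>L 'h \<Rightarrow>\<^sub>L real"
  where "locally_lipschitz_on (chart_map c ` chart_dom c) B"
    "\<And>p v w. p \<in> chart_dom c \<Longrightarrow> v \<in> tangent_space A p \<Longrightarrow> w \<in> tangent_space A p \<Longrightarrow>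
      g p v w = B (chart_map c p) (v c) (w c)"
proof -
  obtain B :: "'h \<Rightarrow> 'h \<Rightarrow>\<^sub>L 'h \<Rightarrow>\<^sub>L real" where B: "C1_on (chart_map c ` chart_dom c) B"
    "\<forall>p\<in>chart_dom c. \<forall>v\<in>tangent_space A p. \<forall>w\<in>tangent_space A p. g p v w = B (chart_map c p) (v c) (w c)"
    using metric assms unfolding riemannian_metric_C1_def by blast
  show ?thesis
    using that[OF C1_on_imp_locally_lipschitz_on[OF B(1) open_chart_image[OF assms]]] B(2) by blast
qed

lemma metric_chart_coercive:
  assumes "c \<in> A" "p \<in> chart_dom c"
  shows "\<exists>m>0. \<forall>v\<in>tangent_space A p. m * (norm (v c))\<^sup>2 \<le> g p v v"
proof -
  obtain m where m: "m > 0" "\<And>v. v \<in> tangent_space A p \<Longrightarrow> m * norm (v c) \<le> metric_norm g p v"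
    using metric assms unfolding riemannian_metric_C1_def by blast
  have "m\<^sup>2 * (norm (v c))\<^sup>2 \<le> g p v v" if v: "v \<in> tangent_space A p" for v
  proof -
    have "(m * norm (v c))\<^sup>2 \<le> (metric_norm g p v)\<^sup>2"
      using m(1) m(2)[OF v] by (intro power_mono) auto
    then show ?thesis
      using metric_nonneg[OF chart_dom_topspace[OF assms] v] by (simp add: metric_norm_def power_mult_distrib)
  qed
  then show ?thesis using m(1) by (intro exI[of _ "m\<^sup>2"]) auto
qed

text \<open>The infimum of a set of reals is a lower bound only if the set is bounded below; lengths are
  nonnegative because velocities are tangent vectors, on which the metric is positive.\<close>

lemma path_dist_le_curve_length:
  assumes "C1_curve M A {0..1} \<gamma>"
  shows "path_dist M A g (\<gamma> 0) (\<gamma> 1) \<le> curve_length A g \<gamma>"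
  unfolding path_dist_def
proof (rule cInf_lower)
  show "curve_length A g \<gamma> \<in> {curve_length A g \<gamma>' |\<gamma>'. C1_curve M A {0..1} \<gamma>' \<and> \<gamma>' 0 = \<gamma> 0 \<and> \<gamma>' 1 = \<gamma> 1}"
    using assms by blast
  have "0 \<le> curve_length A g \<delta>" if \<delta>: "C1_curve M A {0..1} \<delta>" for \<delta>
    unfolding curve_length_def
  proof (rule integral_nonneg_real)
    fix t :: real assume t: "t \<in> {0..1}"
    have "at t within {0..1} \<noteq> bot" using t by (simp add: trivial_limit_within islimpt_Icc)
    then have "velocity A {0..1} \<delta> t \<in> tangent_space A (\<delta> t)"
      by (rule velocity_in_tangent_space[OF \<delta> t])
    moreover have "\<delta> t \<in> topspace M" using \<delta> t by (auto simp: C1_curve_def continuous_map_def)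
    ultimately show "0 \<le> metric_norm g (\<delta> t) (velocity A {0..1} \<delta> t)"
      using metric_nonneg by (simp add: metric_norm_def)
  qed
  then show "bdd_below {curve_length A g \<gamma>' |\<gamma>'. C1_curve M A {0..1} \<gamma>' \<and> \<gamma>' 0 = \<gamma> 0 \<and> \<gamma>' 1 = \<gamma> 1}"
    by (intro bdd_belowI[of _ 0]) blast
qed

end

section \<open>The gradient\<close>

locale riemannian_function = riemannian_manifold M A g
  for M :: "'a topology" and A :: "('a, 'h::{real_inner, complete_space}) chart set"
    and g :: "('a, 'h) metric_tensor" +
  fixes E :: "'a \<Rightarrow> real"
  assumes C11_loc: "C11_loc_function A E"
begin

lemma function_chart:
  assumes c: "c \<in> A"
  obtains E' :: "'h \<Rightarrow> 'h \<Rightarrow>\<^sub>L real"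
  where "locally_lipschitz_on (chart_map c ` chart_dom c) E'"
    "\<And>p. p \<in> chart_dom c \<Longrightarrow> ((E \<circ> chart_inv c) has_derivative E' (chart_map c p)) (at (chart_map c p))"
    "\<And>p v. p \<in> chart_dom c \<Longrightarrow> v \<in> tangent_space A p \<Longrightarrow> differential A E p v = E' (chart_map c p) (v c)"
proof -
  have "C11_loc_on (chart_map c ` chart_dom c) (E \<circ> chart_inv c)"
    using C11_loc c unfolding C11_loc_function_def by blast
  then obtain E' :: "'h \<Rightarrow> 'h \<Rightarrow>\<^sub>L real" where E':
    "\<forall>x\<in>chart_map c ` chart_dom c. ((E \<circ> chart_inv c) has_derivative E' x) (at x)"
    "locally_lipschitz_on (chart_map c ` chart_dom c) E'"
    unfolding C11_loc_on_def by blast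
  have der: "((E \<circ> chart_inv c) has_derivative E' (chart_map c p)) (at (chart_map c p))"
    if "p \<in> chart_dom c" for p using E'(1) that by blast
  show ?thesis
    by (rule that[OF E'(2) der]) (auto intro: differential_eq[OF c _ _ der])
qed

text \<open>In a chart the defining equation reads \<open>B v h = l h\<close> with a symmetric coercive form \<open>B\<close> on the model
  space; strongness of the metric is the coercivity.\<close>

lemma gradient_unique_exists:
  assumes p: "p \<in> topspace M"
  shows "\<exists>!v. v \<in> tangent_space A p \<and> (\<forall>h\<in>tangent_space A p. differential A E p h = g p v h)"
proof -
  obtain c where c: "c \<in> A" "p \<in> chart_dom c" using chart_exists[OF p] by blast
  obtain B where B: "\<And>p v w. p \<in> chart_dom c \<Longrightarrow> v \<in> tangent_space A p \<Longrightarrow> w \<in> tangent_space A p \<Longrightarrow>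
      g p v w = blinfun_apply (blinfun_apply (B (chart_map c p)) (v c)) (w c)"
    by (rule metric_chart[OF c(1)]) blast
  obtain E' where E': "\<And>p v. p \<in> chart_dom c \<Longrightarrow> v \<in> tangent_space A p \<Longrightarrow>
      differential A E p v = blinfun_apply (E' (chart_map c p)) (v c)"
    by (rule function_chart[OF c(1)]) blast
  let ?B = "blinfun_apply (B (chart_map c p))"
  have lift: "tangent_lift c p h \<in> tangent_space A p" "tangent_lift c p h c = h" for h
    by (rule tangent_lift[OF c])+
  have B_lift: "g p (tangent_lift c p h) (tangent_lift c p k) = ?B h k" for h k
    using B[OF c(2) lift(1) lift(1), of h k] lift(2) by simp
  obtain m where m: "m > 0" "\<forall>v\<in>tangent_space A p. m * (norm (v c))\<^sup>2 \<le> g p v v"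
    using metric_chart_coercive[OF c] by blast
  have coercive: "m * (norm h)\<^sup>2 \<le> ?B h h" for h
    using m(2)[rule_format, OF lift(1), of h] lift(2)[of h] B_lift[of h h] by simp
  have sym: "?B h k = ?B k h" for h k
    using metric_sym[OF p lift(1) lift(1), of h k] B_lift by simp
  have bil: "bounded_bilinear (\<lambda>h k. ?B h k)"
    by (rule bounded_bilinear.comp1[OF bounded_bilinear_blinfun_apply blinfun.bounded_linear_right])
  obtain h where h: "\<And>k. E' (chart_map c p) k = ?B h k"
    by (rule lax_milgram_symmetric[OF bil blinfun.bounded_linear_right sym m(1) coercive]) blast
  show ?thesis
  proof (rule ex1I[of _ "tangent_lift c p h"])
    show "tangent_lift c p h \<in> tangent_space A p \<and>
        (\<forall>k\<in>tangent_space A p. differential A E p k = g p (tangent_lift c p h) k)"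
    proof (intro conjI ballI lift(1))
      fix k assume k: "k \<in> tangent_space A p"
      show "differential A E p k = g p (tangent_lift c p h) k"
        using E'[OF c(2) k] B[OF c(2) lift(1) k, of h] lift(2)[of h] h by simp
    qed
    fix v assume v: "v \<in> tangent_space A p \<and> (\<forall>h\<in>tangent_space A p. differential A E p h = g p v h)"
    have "?B (v c) k = ?B h k" for k
      using v lift(1)[of k] lift(2)[of k] E'[OF c(2) lift(1), of k] B[OF c(2) conjunct1[OF v] lift(1), of k] h[of k] by simp
    then have "?B (v c - h) (v c - h) = 0"
      by (simp add: blinfun.diff_left blinfun.diff_right)
    then have "m * (norm (v c - h))\<^sup>2 \<le> 0" using coercive[of "v c - h"] by simp
    then have "v c = h" using m(1) by (simp add: mult_le_0_iff)
    then show "v = tangent_lift c p h"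
      using tangent_eqI[OF conjunct1[OF v] lift(1) c, of h] lift(2) by simp
  qed
qed

lemma gradient_properties:
  assumes p: "p \<in> topspace M"
  shows gradient_tangent: "gradient A g E p \<in> tangent_space A p"
    and gradient_metric: "\<And>h. h \<in> tangent_space A p \<Longrightarrow> differential A E p h = g p (gradient A g E p) h"
  using theI'[OF gradient_unique_exists[OF p]] unfolding gradient_def by blast+

lemma gradient_eqI:
  assumes p: "p \<in> topspace M" and v: "v \<in> tangent_space A p"
    and "\<And>h. h \<in> tangent_space A p \<Longrightarrow> differential A E p h = g p v h"
  shows "gradient A g E p = v"
  unfolding gradient_def by (rule the1_equality[OF gradient_unique_exists[OF p]]) (use assms in blast)

text \<open>In the chart \<open>c\<close> the gradient at \<open>x\<close> solves \<open>B x v h = E' x h\<close> for all \<open>h\<close>, where the form \<open>B x\<close> of the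
  metric and the derivative \<open>E' x\<close> of \<open>E\<close> depend locally Lipschitz continuously on \<open>x\<close>.\<close>

lemma gradient_locally_lipschitz:
  assumes c: "c \<in> A"
  shows "locally_lipschitz_on (chart_map c ` chart_dom c) (\<lambda>x. gradient A g E (chart_inv c x) c)"
proof -
  let ?S = "chart_map c ` chart_dom c"
  obtain B where B: "locally_lipschitz_on ?S B"
    "\<And>p v w. p \<in> chart_dom c \<Longrightarrow> v \<in> tangent_space A p \<Longrightarrow> w \<in> tangent_space A p \<Longrightarrow>
      g p v w = blinfun_apply (blinfun_apply (B (chart_map c p)) (v c)) (w c)"
    by (rule metric_chart[OF c]) blast
  obtain E' where E': "locally_lipschitz_on ?S E'" "\<And>p v. p \<in> chart_dom c \<Longrightarrow> v \<in> tangent_space A p \<Longrightarrow>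
      differential A E p v = blinfun_apply (E' (chart_map c p)) (v c)"
    by (rule function_chart[OF c]) blast
  show ?thesis
  proof (rule locally_lipschitz_on_solution[OF B(1) E'(1)])
    fix x assume x: "x \<in> ?S"
    define p where "p = chart_inv c x"
    have p: "p \<in> chart_dom c" "chart_map c p = x"
      unfolding p_def by (rule chart_inv_in_dom[OF x], rule chart_map_inv[OF x])
    have top: "p \<in> topspace M" by (rule chart_dom_topspace[OF c p(1)])
    have lift: "tangent_lift c p h \<in> tangent_space A p" "tangent_lift c p h c = h" for h
      by (rule tangent_lift[OF c p(1)])+
    obtain m where m: "m > 0" "\<forall>v\<in>tangent_space A p. m * (norm (v c))\<^sup>2 \<le> g p v v"
      using metric_chart_coercive[OF c p(1)] by blast
    have "m * (norm h)\<^sup>2 \<le> B x h h" for h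
      using m(2)[rule_format, OF lift(1), of h] lift(2)[of h] B(2)[OF p(1) lift(1) lift(1), of h h] p(2) by simp
    then show "\<exists>m>0. \<forall>h. m * (norm h)\<^sup>2 \<le> B x h h" using m(1) by blast
    fix h
    have "B x (gradient A g E p c) h = g p (gradient A g E p) (tangent_lift c p h)"
      using B(2)[OF p(1) gradient_tangent[OF top] lift(1), of h] lift(2)[of h] p(2) by simp
    also have "\<dots> = differential A E p (tangent_lift c p h)" using gradient_metric[OF top lift(1)] by simp
    also have "\<dots> = E' x h" using E'(2)[OF p(1) lift(1), of h] lift(2)[of h] p(2) by simp
    finally show "B x (gradient A g E (chart_inv c x) c) h = E' x h" by (simp add: p_def)
  qed
qed

definition negative_gradient :: "'a \<Rightarrow> ('a, 'h) tangent" where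
  "negative_gradient p = (\<lambda>c. - gradient A g E p c)"

sublocale flow: manifold_vector_field M A negative_gradient
proof
  show "negative_gradient p \<in> tangent_space A p" if "p \<in> topspace M" for p
    unfolding negative_gradient_def by (rule tangent_uminus[OF that gradient_tangent[OF that]])
  show "locally_lipschitz_on (chart_map c ` chart_dom c) (\<lambda>x. negative_gradient (chart_inv c x) c)" if "c \<in> A" for c
    using gradient_locally_lipschitz[OF that]
    by (simp add: locally_lipschitz_on_def negative_gradient_def)
qed

section \<open>The energy along the gradient flow\<close>

definition slope_squared :: "'a \<Rightarrow> real" where
  "slope_squared p = g p (gradient A g E p) (gradient A g E p)"

lemma slope_squared_nonneg: "p \<in> topspace M \<Longrightarrow> slope_squared p \<ge> 0"
  unfolding slope_squared_def by (rule metric_nonneg[OF _ gradient_tangent])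

lemma metric_norm_negative_gradient:
  assumes p: "p \<in> topspace M"
  shows "metric_norm g p (\<lambda>c. k *\<^sub>R negative_gradient p c) = \<bar>k\<bar> * sqrt (slope_squared p)"
proof -
  let ?v = "gradient A g E p"
  have v: "?v \<in> tangent_space A p" by (rule gradient_tangent[OF p])
  have sv: "(\<lambda>c. (- k) *\<^sub>R ?v c) \<in> tangent_space A p" by (rule tangent_scale[OF p v])
  have "g p (\<lambda>c. (- k) *\<^sub>R ?v c) (\<lambda>c. (- k) *\<^sub>R ?v c) = - k * (- k * g p ?v ?v)"
    unfolding metric_scale[OF p v sv] metric_sym[OF p v sv] metric_scale[OF p v v] ..
  then have "g p (\<lambda>c. k *\<^sub>R negative_gradient p c) (\<lambda>c. k *\<^sub>R negative_gradient p c) = k\<^sup>2 * slope_squared p"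
    by (simp add: negative_gradient_def slope_squared_def power2_eq_square)
  then show ?thesis by (simp add: metric_norm_def real_sqrt_mult)
qed

lemma energy_derivative:
  assumes \<xi>: "flow.integral_curve I \<xi>" and t: "t \<in> I"
  shows "((E \<circ> \<xi>) has_real_derivative - slope_squared (\<xi> t)) (at t within I)"
proof -
  have top: "\<xi> t \<in> topspace M" by (rule flow.integral_curve_topspace[OF \<xi> t])
  obtain c where c: "c \<in> A" "\<xi> t \<in> chart_dom c" using chart_exists[OF top] by blast
  let ?v = "gradient A g E (\<xi> t)"
  have v: "?v \<in> tangent_space A (\<xi> t)" by (rule gradient_tangent[OF top])
  obtain E' where E': "\<And>p. p \<in> chart_dom c \<Longrightarrow> ((E \<circ> chart_inv c) has_derivative blinfun_apply (E' (chart_map c p))) (at (chart_map c p))"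
    "\<And>p v. p \<in> chart_dom c \<Longrightarrow> v \<in> tangent_space A p \<Longrightarrow>
      differential A E p v = blinfun_apply (E' (chart_map c p)) (v c)"
    by (rule function_chart[OF c(1)]) blast
  have "((E \<circ> \<xi>) has_vector_derivative E' (chart_map c (\<xi> t)) (negative_gradient (\<xi> t) c)) (at t within I)"
    by (rule curve_derivative[OF flow.integral_curve_continuous[OF \<xi>] t c flow.integral_curve_derivative[OF \<xi> t c] E'(1)[OF c(2)]])
  moreover have "E' (chart_map c (\<xi> t)) (negative_gradient (\<xi> t) c) = - slope_squared (\<xi> t)"
    using E'(2)[OF c(2) v] gradient_metric[OF top v]
    by (simp add: negative_gradient_def blinfun.minus_right slope_squared_def)
  ultimately show ?thesis by (simp add: has_real_derivative_iff_has_vector_derivative)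
qed

text \<open>The two bounds suffice for the Palais-Smale condition: a sequence along which
  \<open>\<parallel>\<nabla>E\<parallel>\<close> tends to 0 is a Palais-Smale sequence as soon as \<open>E\<close> is bounded above on it.\<close>

lemma differential_norm_bounds:
  assumes p: "p \<in> topspace M"
  shows "0 \<le> differential_norm A g E p" "differential_norm A g E p \<le> sqrt (slope_squared p)"
proof -
  let ?U = "{h \<in> tangent_space A p. metric_norm g p h \<le> 1}"
  have zero: "(\<lambda>_. 0) \<in> ?U"
    using tangent_zero[OF p] metric_zero[OF p tangent_zero[OF p]] by (simp add: metric_norm_def)
  have le: "\<bar>differential A E p h\<bar> \<le> sqrt (slope_squared p)" if "h \<in> ?U" for h
  proof -
    have h: "h \<in> tangent_space A p" "metric_norm g p h \<le> 1" using that by auto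
    have "\<bar>differential A E p h\<bar> \<le> metric_norm g p (gradient A g E p) * metric_norm g p h"
      unfolding gradient_metric[OF p h(1)] by (rule metric_Cauchy_Schwarz[OF p gradient_tangent[OF p] h(1)])
    also have "\<dots> \<le> metric_norm g p (gradient A g E p) * 1"
      using h(2) metric_nonneg[OF p gradient_tangent[OF p]] by (intro mult_left_mono) (auto simp: metric_norm_def)
    finally show ?thesis by (simp add: metric_norm_def slope_squared_def)
  qed
  show "differential_norm A g E p \<le> sqrt (slope_squared p)"
    unfolding differential_norm_def by (rule cSUP_least) (use zero le in blast)+
  have "0 \<le> \<bar>differential A E p (\<lambda>_. 0)\<bar>" by simp
  also have "\<dots> \<le> differential_norm A g E p"
    unfolding differential_norm_def
    by (rule cSUP_upper[OF zero]) (rule bdd_aboveI2, rule le)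
  finally show "0 \<le> differential_norm A g E p" .
qed

lemma critical_pointI:
  assumes p: "p \<in> topspace M" and "slope_squared p = 0"
  shows "critical_point M A E p"
proof -
  have "gradient A g E p = (\<lambda>_. 0)"
    by (rule metric_eq_0[OF p gradient_tangent[OF p]]) (use assms in \<open>simp add: slope_squared_def\<close>)
  then show ?thesis
    unfolding critical_point_def using p gradient_metric[OF p] metric_zero[OF p] by simp
qed

lemma tendsto_slope_squared:
  assumes lim: "limitin M f p F" and top: "\<forall>\<^sub>F s in F. f s \<in> topspace M"
  shows "((\<lambda>s. slope_squared (f s)) \<longlongrightarrow> slope_squared p) F"
proof -
  have p: "p \<in> topspace M" by (rule limitin_topspace[OF lim])
  obtain c where c: "c \<in> A" "p \<in> chart_dom c" using chart_exists[OF p] by blast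
  obtain B where B: "locally_lipschitz_on (chart_map c ` chart_dom c) B"
    "\<And>p v w. p \<in> chart_dom c \<Longrightarrow> v \<in> tangent_space A p \<Longrightarrow> w \<in> tangent_space A p \<Longrightarrow>
      g p v w = blinfun_apply (blinfun_apply (B (chart_map c p)) (v c)) (w c)"
    by (rule metric_chart[OF c(1)]) blast
  have slope: "slope_squared q = B (chart_map c q) (negative_gradient q c) (negative_gradient q c)"
    if q: "q \<in> chart_dom c" for q
    using B(2)[OF q] gradient_tangent[OF chart_dom_topspace[OF c(1) q]]
    by (simp add: slope_squared_def negative_gradient_def blinfun.minus_right blinfun.minus_left)
  have "isCont B (chart_map c p)"
    using locally_lipschitz_on_imp_continuous_on[OF B(1) open_chart_image[OF c(1)]] open_chart_image[OF c(1)] c(2)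
    by (simp add: continuous_on_eq_continuous_at)
  then have "((\<lambda>s. B (chart_map c (f s))) \<longlongrightarrow> B (chart_map c p)) F"
    using limitin_chart(2)[OF lim c] by (rule isCont_tendsto_compose)
  then have "((\<lambda>s. B (chart_map c (f s)) (negative_gradient (f s) c) (negative_gradient (f s) c)) \<longlongrightarrow>
      B (chart_map c p) (negative_gradient p c) (negative_gradient p c)) F"
    by (intro blinfun.tendsto flow.tendsto_vector_field[OF lim c])
  then have "((\<lambda>s. B (chart_map c (f s)) (negative_gradient (f s) c) (negative_gradient (f s) c)) \<longlongrightarrow>
      slope_squared p) F" unfolding slope[OF c(2)] .
  then show ?thesis
    by (rule Lim_transform_eventually)
      (use limitin_chart(1)[OF lim c] in \<open>eventually_elim\<close>, simp add: slope)
qed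

lemma energy_decreasing:
  assumes \<xi>: "flow.integral_curve I \<xi>" and ab: "{a..b} \<subseteq> I" "a \<le> b"
  shows "E (\<xi> b) \<le> E (\<xi> a)"
proof (cases "a = b")
  case False
  have sub: "flow.integral_curve {a..b} \<xi>" by (rule flow.integral_curve_subset[OF \<xi> ab(1)])
  obtain t where t: "t \<in> {a<..<b}" "(E \<circ> \<xi>) b - (E \<circ> \<xi>) a = (b - a) * - slope_squared (\<xi> t)"
    by (rule mvt_within[OF _ energy_derivative[OF sub]]) (use False ab in auto)
  have "slope_squared (\<xi> t) \<ge> 0"
    by (rule slope_squared_nonneg[OF flow.integral_curve_topspace[OF sub]]) (use t in auto)
  then have "(b - a) * slope_squared (\<xi> t) \<ge> 0" using ab by simp
  then show ?thesis using t(2) by simp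
qed simp

text \<open>On the segment between the two times the speed \<open>\<parallel>\<nabla>E\<parallel>\<close> is bounded by \<open>(1 + \<parallel>\<nabla>E\<parallel>\<^sup>2) / 2\<close>, the derivative
  of \<open>(t - E (\<xi> t)) / 2\<close>; integration gives the bound. In contrast to the Cauchy-Schwarz estimate
  by \<open>sqrt (b - a)\<close>, the bound is the increment of one function, so the Cauchy property
  is read off from the convergence of this function.\<close>

lemma path_dist_integral_curve_le:
  assumes \<xi>: "flow.integral_curve I \<xi>" and I: "is_interval I" "a \<in> I" "b \<in> I"
  shows "path_dist M A g (\<xi> a) (\<xi> b) \<le> \<bar>(b - E (\<xi> b)) / 2 - (a - E (\<xi> a)) / 2\<bar>"
proof -
  define \<gamma> where "\<gamma> = (\<lambda>r. \<xi> (a + r * (b - a)))"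
  define h where "h t = (t - E (\<xi> t)) / 2" for t
  \<comment> \<open>The sign covers the case \<open>b < a\<close>, in which the curve is run backwards.\<close>
  define \<sigma> where "\<sigma> = sgn (b - a)"
  define \<psi> where "\<psi> r = \<bar>b - a\<bar> * ((1 + slope_squared (\<gamma> r)) / 2)" for r
  have inI: "a + r * (b - a) \<in> I" if "r \<in> {0..1}" for r
  proof -
    have "a + r * (b - a) \<in> closed_segment a b"
      using that by (auto simp: closed_segment_def algebra_simps intro!: exI[of _ r])
    then show ?thesis using I closed_segment_subset[of a I b] by (auto simp: is_interval_convex_1)
  qed
  have curve: "C1_curve M A {0..1} \<gamma>"
    and der: "\<And>r d. r \<in> {0..1} \<Longrightarrow> d \<in> A \<Longrightarrow> \<gamma> r \<in> chart_dom d \<Longrightarrow>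
      ((chart_map d \<circ> \<gamma>) has_vector_derivative (b - a) *\<^sub>R negative_gradient (\<gamma> r) d) (at r within {0..1})"
    unfolding \<gamma>_def by (rule flow.integral_curve_affine[OF \<xi> inI]; assumption)+
  have top: "\<gamma> r \<in> topspace M" if "r \<in> {0..1}" for r
    unfolding \<gamma>_def by (rule flow.integral_curve_topspace[OF \<xi> inI[OF that]])
  have norm: "metric_norm g (\<gamma> r) (velocity A {0..1} \<gamma> r) = \<bar>b - a\<bar> * sqrt (slope_squared (\<gamma> r))"
    if r: "r \<in> {0..1}" for r
  proof -
    have bot: "at r within {0..1} \<noteq> bot" using r by (simp add: trivial_limit_within islimpt_Icc)
    obtain c where c: "c \<in> A" "\<gamma> r \<in> chart_dom c" using chart_exists[OF top[OF r]] by blast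
    have "velocity A {0..1} \<gamma> r = (\<lambda>d. (b - a) *\<^sub>R negative_gradient (\<gamma> r) d)"
    proof (rule tangent_eqI[OF velocity_in_tangent_space[OF curve r bot] _ c])
      show "(\<lambda>d. (b - a) *\<^sub>R negative_gradient (\<gamma> r) d) \<in> tangent_space A (\<gamma> r)"
        by (rule tangent_scale[OF top[OF r] flow.X_tangent[OF top[OF r]]])
      show "velocity A {0..1} \<gamma> r c = (b - a) *\<^sub>R negative_gradient (\<gamma> r) c"
        unfolding velocity_def using vector_derivative_within[OF bot der[OF r c]] c by simp
    qed
    then show ?thesis using metric_norm_negative_gradient[OF top[OF r]] by simp
  qed
  have "(\<psi> has_integral \<sigma> * h (a + 1 * (b - a)) - \<sigma> * h (a + 0 * (b - a))) {0..1}"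
  proof (rule fundamental_theorem_of_calculus)
    fix r :: real assume r: "r \<in> {0..1}"
    have h': "(h has_vector_derivative (1 + slope_squared (\<gamma> r)) / 2) (at (a + r * (b - a)) within (\<lambda>r. a + r * (b - a)) ` {0..1})"
    proof -
      have "((E \<circ> \<xi>) has_real_derivative - slope_squared (\<gamma> r)) (at (a + r * (b - a)) within I)"
        unfolding \<gamma>_def by (rule energy_derivative[OF \<xi> inI[OF r]])
      from DERIV_cdivide[OF DERIV_diff[OF DERIV_ident this], of 2]
      have "(h has_vector_derivative (1 + slope_squared (\<gamma> r)) / 2) (at (a + r * (b - a)) within I)"
        by (simp add: h_def[abs_def] o_def has_real_derivative_iff_has_vector_derivative)
      moreover have "(\<lambda>r. a + r * (b - a)) ` {0..1} \<subseteq> I" using inI by blast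
      ultimately show ?thesis by (rule has_vector_derivative_within_subset)
    qed
    have "((\<lambda>r. a + r * (b - a)) has_vector_derivative (b - a)) (at r within {0..1})"
      by (auto intro!: derivative_eq_intros)
    from vector_diff_chain_within[OF this h']
    have "((\<lambda>r. h (a + r * (b - a))) has_vector_derivative (b - a) * ((1 + slope_squared (\<gamma> r)) / 2)) (at r within {0..1})"
      by (simp add: o_def)
    from has_vector_derivative_mult_right[OF this, of \<sigma>]
    show "((\<lambda>r. \<sigma> * h (a + r * (b - a))) has_vector_derivative \<psi> r) (at r within {0..1})"
      by (simp add: \<psi>_def \<sigma>_def abs_sgn mult_ac)
  qed simp
  then have int: "(\<psi> has_integral \<sigma> * (h b - h a)) {0..1}" by (simp add: algebra_simps)
  have "path_dist M A g (\<xi> a) (\<xi> b) \<le> curve_length A g \<gamma>"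
    using path_dist_le_curve_length[OF curve] by (simp add: \<gamma>_def)
  also have "\<dots> \<le> \<sigma> * (h b - h a)"
    unfolding curve_length_def
  proof (rule integral_le_majorant[OF int])
    fix r :: real assume r: "r \<in> {0..1}"
    have s: "slope_squared (\<gamma> r) \<ge> 0" by (rule slope_squared_nonneg[OF top[OF r]])
    then show "0 \<le> metric_norm g (\<gamma> r) (velocity A {0..1} \<gamma> r)" unfolding norm[OF r] by simp
    have "0 \<le> (sqrt (slope_squared (\<gamma> r)) - 1)\<^sup>2" by simp
    then have "sqrt (slope_squared (\<gamma> r)) \<le> (1 + slope_squared (\<gamma> r)) / 2"
      using s by (simp add: power2_eq_square algebra_simps)
    then show "metric_norm g (\<gamma> r) (velocity A {0..1} \<gamma> r) \<le> \<psi> r"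
      unfolding norm[OF r] \<psi>_def by (rule mult_left_mono) simp
  qed
  also have "\<dots> \<le> \<bar>h b - h a\<bar>" unfolding \<sigma>_def using abs_ge_self[of "h b - h a"] abs_ge_minus_self[of "h b - h a"] by (simp add: sgn_if)
  finally show ?thesis by (simp add: h_def)
qed

text \<open>The function \<open>(t - E (\<xi> t)) / 2\<close> increases and is bounded on \<open>[0,T)\<close>, hence converges; by
  \<open>path_dist_integral_curve_le\<close> the curve is then Cauchy in the path metric.\<close>

lemma integral_curve_limit_at_finite_time:
  assumes bdd: "bdd_below (E ` topspace M)"
    and complete: "\<And>x. path_Cauchy M A g x \<Longrightarrow> bounded (range (\<lambda>k. E (x k))) \<Longrightarrow>
      \<exists>y. limitin M x y sequentially"
    and T: "T > 0" and \<xi>: "flow.integral_curve {0..<T} \<xi>"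
  shows "\<exists>s y. (\<forall>k::nat. s k \<in> {0..<T}) \<and> s \<longlonglongrightarrow> T \<and> limitin M (\<lambda>k. \<xi> (s k)) y sequentially"
proof -
  define s where "s k = T - T * inverse (real (Suc k))" for k
  define h where "h t = (t - E (\<xi> t)) / 2" for t
  obtain m where m: "\<And>p. p \<in> topspace M \<Longrightarrow> m \<le> E p" using bdd by (auto simp: bdd_below_def)
  have s: "s k \<in> {0..<T}" for k
    using T by (simp add: s_def field_simps)
  have s_mono: "s i \<le> s j" if "i \<le> j" for i j
    using T that by (auto simp: s_def intro!: mult_left_mono le_imp_inverse_le)
  have "s \<longlonglongrightarrow> T - T * 0"
    unfolding s_def by (intro tendsto_intros LIMSEQ_inverse_real_of_nat)
  then have s_lim: "s \<longlonglongrightarrow> T" by simp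
  have top: "\<xi> (s k) \<in> topspace M" for k by (rule flow.integral_curve_topspace[OF \<xi> s])
  have dec: "E (\<xi> b) \<le> E (\<xi> a)" if "a \<in> {0..<T}" "b \<in> {0..<T}" "a \<le> b" for a b
    by (rule energy_decreasing[OF \<xi> _ that(3)]) (use that in auto)
  have h_mono: "h (s i) \<le> h (s j)" if "i \<le> j" for i j
    using s_mono[OF that] dec[OF s s s_mono[OF that]] by (simp add: h_def)
  have bounded: "\<forall>k. h (s k) \<le> (T - m) / 2"
  proof
    show "h (s k) \<le> (T - m) / 2" for k using s[of k] m[OF top[of k]] by (simp add: h_def)
  qed
  have "incseq (\<lambda>k. h (s k))" by (rule monoI) (rule h_mono)
  then obtain l where "(\<lambda>k. h (s k)) \<longlonglongrightarrow> l" by (rule incseq_convergent[OF _ bounded])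
  then have Cauchy: "Cauchy (\<lambda>k. h (s k))" by (rule LIMSEQ_imp_Cauchy)
  have small: "\<exists>N\<ge>0. \<forall>m\<ge>N. \<forall>n\<ge>N. path_dist M A g (\<xi> (s m)) (\<xi> (s n)) < e" if e: "e > 0" for e
  proof -
    obtain N where N: "\<And>m n. m \<ge> N \<Longrightarrow> n \<ge> N \<Longrightarrow> dist (h (s m)) (h (s n)) < e"
      using Cauchy e unfolding Cauchy_def by meson
    have "path_dist M A g (\<xi> (s m)) (\<xi> (s n)) < e" if "m \<ge> N" "n \<ge> N" for m n
      using path_dist_integral_curve_le[OF \<xi> _ s s, of m n] N[OF that(2,1)]
      by (simp add: h_def dist_real_def is_interval_co)
    then show ?thesis by blast
  qed
  let ?K = "connected_component_of_set M (\<xi> (s 0))"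
  have component: "?K \<in> connected_components_of M"
    by (rule iffD2[OF connected_component_in_connected_components_of top])
  have in_component: "\<xi> (s k) \<in> ?K" for k
    by (rule flow.integral_curve_connected[OF \<xi> convex_connected[OF convex_real_interval(7)] s s])
  have "path_Cauchy M A g (\<lambda>k. \<xi> (s k))"
    unfolding path_Cauchy_def
  proof (rule conjI[OF allI[OF top]], rule bexI[OF _ component], rule exI[of _ 0], rule conjI)
    show "\<forall>k\<ge>0. \<xi> (s k) \<in> ?K" by (intro allI impI in_component)
    show "\<forall>e>0. \<exists>N\<ge>0. \<forall>m\<ge>N. \<forall>n\<ge>N. path_dist M A g (\<xi> (s m)) (\<xi> (s n)) < e"
      by (intro allI impI small)
  qed
  moreover have "bounded (range (\<lambda>k. E (\<xi> (s k))))"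
  proof (rule bounded_subset[OF bounded_closed_interval])
    show "range (\<lambda>k. E (\<xi> (s k))) \<subseteq> {m..E (\<xi> (s 0))}" using m[OF top] dec[OF s s s_mono] by auto
  qed
  ultimately obtain y where "limitin M (\<lambda>k. \<xi> (s k)) y sequentially" using complete by blast
  then show ?thesis using s s_lim by blast
qed

lemma gradient_flow_solution_iff:
  "gradient_flow_solution M A g E x \<xi> \<longleftrightarrow> flow.integral_curve {0..} \<xi> \<and> \<xi> 0 = x"
proof -
  have "flow.integral_curve {0..} \<xi> \<longleftrightarrow>
      C1_curve M A {0..} \<xi> \<and> (\<forall>t\<in>{0..}. velocity A {0..} \<xi> t = negative_gradient (\<xi> t))"
  proof (rule flow.integral_curve_iff_C1_curve)
    fix t :: real assume "t \<in> {0..}"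
    then have "t islimpt {t..t + 1}" "{t..t + 1} \<subseteq> {0..}" by (auto simp: islimpt_Icc)
    then have "t islimpt {0..}" by (rule islimpt_subset)
    then show "at t within {0..} \<noteq> bot" by (simp add: trivial_limit_within)
  qed
  then show ?thesis
    unfolding gradient_flow_solution_def negative_gradient_def by (simp add: Ball_def conj_ac)
qed

lemma gradient_flow_unique:
  assumes "flow.integral_curve {0..} \<xi>" "flow.integral_curve {0..} \<eta>" "\<xi> 0 = \<eta> 0" "t \<ge> 0"
  shows "\<xi> t = \<eta> t"
  by (rule flow.integral_curve_unique[of 0 t \<xi> \<eta>])
    (use assms in \<open>auto intro: flow.integral_curve_subset\<close>)

text \<open>The differences \<open>E (\<xi> k) - E (\<xi> (k + 1))\<close> tend to 0, and by the mean value theorem each of them is the value of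
  \<open>\<parallel>\<nabla>E\<parallel>\<^sup>2\<close> at some time between \<open>k\<close> and \<open>k + 1\<close>.\<close>

lemma gradient_flow_slope_tends_to_0:
  assumes bdd: "bdd_below (E ` topspace M)" and \<xi>: "flow.integral_curve {0..} \<xi>"
  obtains t :: "nat \<Rightarrow> real" where "\<And>k. real k < t k" "(\<lambda>k. slope_squared (\<xi> (t k))) \<longlonglongrightarrow> 0"
proof -
  obtain m where m: "\<And>p. p \<in> topspace M \<Longrightarrow> m \<le> E p" using bdd by (auto simp: bdd_below_def)
  define f where "f k = E (\<xi> (real k))" for k
  have lower: "\<forall>k. m \<le> f k"
    unfolding f_def by (intro allI m[OF flow.integral_curve_topspace[OF \<xi>]]) simp
  have "decseq f"
    unfolding decseq_def f_def by (intro allI impI energy_decreasing[OF \<xi>]) simp_all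
  then obtain l where l: "f \<longlonglongrightarrow> l" by (rule decseq_convergent[OF _ lower])
  have "\<exists>t. real k < t \<and> slope_squared (\<xi> t) = f k - f (Suc k)" for k
  proof -
    have sub: "flow.integral_curve {real k..real (Suc k)} \<xi>" by (rule flow.integral_curve_subset[OF \<xi>]) auto
    obtain t where "t \<in> {real k<..<real (Suc k)}"
      "(E \<circ> \<xi>) (real (Suc k)) - (E \<circ> \<xi>) (real k) = (real (Suc k) - real k) * - slope_squared (\<xi> t)"
      by (rule mvt_within[OF _ energy_derivative[OF sub]]) auto
    then show ?thesis by (intro exI[of _ t]) (auto simp: f_def)
  qed
  then obtain t where t: "\<And>k. real k < t k" "\<And>k. slope_squared (\<xi> (t k)) = f k - f (Suc k)" by metis
  have "(\<lambda>k. f k - f (Suc k)) \<longlonglongrightarrow> l - l" by (intro tendsto_diff l LIMSEQ_Suc)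
  then show ?thesis using that[of t] t by simp
qed

lemma gradient_flow_subconverges:
  assumes bdd: "bdd_below (E ` topspace M)" and PS: "Palais_Smale_condition M A g E"
    and \<xi>: "flow.integral_curve {0..} \<xi>"
  obtains y where "subconverges M \<xi> y" "critical_point M A E y"
proof -
  obtain t :: "nat \<Rightarrow> real" where t: "\<And>k. real k < t k" and slope: "(\<lambda>k. slope_squared (\<xi> (t k))) \<longlonglongrightarrow> 0"
    using gradient_flow_slope_tends_to_0[OF bdd \<xi>] by blast
  have t0: "0 \<le> t k" for k using t[of k] by linarith
  have top: "\<xi> (t k) \<in> topspace M" for k by (rule flow.integral_curve_topspace[OF \<xi>]) (simp add: t0)
  have "Palais_Smale_sequence M A g E (\<lambda>k. \<xi> (t k))"
    unfolding Palais_Smale_sequence_def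
  proof (intro conjI allI top)
    show "bdd_above (range (\<lambda>k. E (\<xi> (t k))))"
      by (rule bdd_aboveI2[of _ _ "E (\<xi> 0)"]) (rule energy_decreasing[OF \<xi>], use t0 in auto)
    have "(\<lambda>k. sqrt (slope_squared (\<xi> (t k)))) \<longlonglongrightarrow> sqrt 0" by (intro tendsto_real_sqrt slope)
    then have lim: "(\<lambda>k. sqrt (slope_squared (\<xi> (t k)))) \<longlonglongrightarrow> 0" by simp
    show "(\<lambda>k. differential_norm A g E (\<xi> (t k))) \<longlonglongrightarrow> 0"
      by (rule tendsto_sandwich[OF _ _ tendsto_const lim]) (simp_all add: differential_norm_bounds top)
  qed
  then obtain r y where r: "strict_mono r" and y: "limitin M ((\<lambda>k. \<xi> (t k)) \<circ> r) y sequentially"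
    using PS unfolding Palais_Smale_condition_def by blast
  have "subconverges M \<xi> y"
    unfolding subconverges_def
  proof (intro exI[of _ "t \<circ> r"] conjI allI)
    show "0 \<le> (t \<circ> r) k" for k by (simp add: t0)
    have "filterlim t at_top sequentially"
      by (rule filterlim_at_top_mono[OF filterlim_real_sequentially]) (simp add: t less_imp_le)
    then show "filterlim (t \<circ> r) at_top sequentially"
      unfolding o_def by (rule filterlim_compose[OF _ filterlim_subseq[OF r]])
    show "limitin M (\<lambda>k. \<xi> ((t \<circ> r) k)) y sequentially" using y by (simp add: o_def)
  qed
  moreover have "critical_point M A E y"
  proof (rule critical_pointI[OF limitin_topspace[OF y]])
    have "(\<lambda>k. slope_squared (((\<lambda>k. \<xi> (t k)) \<circ> r) k)) \<longlonglongrightarrow> slope_squared y"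
      by (rule tendsto_slope_squared[OF y]) (simp add: top)
    moreover have "(\<lambda>k. slope_squared (((\<lambda>k. \<xi> (t k)) \<circ> r) k)) \<longlonglongrightarrow> 0"
      using LIMSEQ_subseq_LIMSEQ[OF slope r] by (simp add: o_def)
    ultimately show "slope_squared y = 0" by (rule LIMSEQ_unique)
  qed
  ultimately show ?thesis by (rule that)
qed

section \<open>Equivariance under isometries\<close>

lemma differential_invariant:
  assumes f: "C1_map M A f" and inv: "\<And>p. p \<in> topspace M \<Longrightarrow> E (f p) = E p"
    and p: "p \<in> topspace M" and v: "v \<in> tangent_space A p"
  shows "differential A E (f p) (tangent_map A f p v) = differential A E p v"
proof -
  have fp: "f p \<in> topspace M" using C1_map_continuous[OF f] p by (auto simp: continuous_map_def)
  obtain c where c: "c \<in> A" "p \<in> chart_dom c" using chart_exists[OF p] by blast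
  obtain d where d: "d \<in> A" "f p \<in> chart_dom d" using chart_exists[OF fp] by blast
  obtain a where a: "((chart_map d \<circ> f \<circ> chart_inv c) has_derivative a) (at (chart_map c p))"
    by (rule C1_map_chart[OF f c(1) d(1) c(2) d(2)])
  obtain E' where E': "\<And>p. p \<in> chart_dom d \<Longrightarrow> ((E \<circ> chart_inv d) has_derivative blinfun_apply (E' (chart_map d p))) (at (chart_map d p))"
    "\<And>p v. p \<in> chart_dom d \<Longrightarrow> v \<in> tangent_space A p \<Longrightarrow>
      differential A E p v = blinfun_apply (E' (chart_map d p)) (v d)"
    by (rule function_chart[OF d(1)]) blast
  have "((E \<circ> f \<circ> chart_inv c) has_derivative (\<lambda>h. E' (chart_map d (f p)) (a h))) (at (chart_map c p))"
    by (rule has_derivative_chart_compose[OF C1_map_continuous[OF f] c d a E'(1)[OF d(2)]])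
  moreover have "\<forall>\<^sub>F x in nhds (chart_map c p). (E \<circ> f \<circ> chart_inv c) x = (E \<circ> chart_inv c) x"
    using eventually_nhds_chart[OF c openin_topspace p]
    by eventually_elim (simp add: inv)
  ultimately have "((E \<circ> chart_inv c) has_derivative (\<lambda>h. E' (chart_map d (f p)) (a h))) (at (chart_map c p))"
    by (simp only: has_derivative_cong_nhds)
  from differential_eq[OF c v this]
  have "differential A E p v = E' (chart_map d (f p)) (a (v c))" .
  also have "a (v c) = tangent_map A f p v d" by (rule tangent_map_eq[where f = f, OF c v d a, symmetric])
  also have "E' (chart_map d (f p)) (tangent_map A f p v d) = differential A E (f p) (tangent_map A f p v)"
    by (rule E'(2)[OF d(2) tangent_map_in_tangent_space[OF f p v], symmetric])
  finally show ?thesis by simp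
qed

text \<open>The image of the gradient under the tangent map has the defining property of the gradient
  at \<open>\<Gamma> p\<close>, tested on vectors of the form \<open>D\<Gamma> k\<close>. These are all tangent vectors at \<open>\<Gamma> p\<close> since the
  inverse of \<open>\<Gamma>\<close> is again of class \<open>C\<^sup>1\<close>.\<close>

lemma gradient_equivariant:
  assumes iso: "C1_isometry M A g \<Gamma>" and inv: "\<And>p. p \<in> topspace M \<Longrightarrow> E (\<Gamma> p) = E p"
    and p: "p \<in> topspace M"
  shows "gradient A g E (\<Gamma> p) = tangent_map A \<Gamma> p (gradient A g E p)"
proof -
  define \<Delta> where "\<Delta> = inv_into (topspace M) \<Gamma>"
  have bij: "bij_betw \<Gamma> (topspace M) (topspace M)" and \<Gamma>: "C1_map M A \<Gamma>" and \<Delta>: "C1_map M A \<Delta>"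
    using iso by (simp_all add: C1_isometry_def C1_diffeomorphism_def \<Delta>_def)
  have isometry: "g (\<Gamma> p) (tangent_map A \<Gamma> p h) (tangent_map A \<Gamma> p k) = g p h k"
    if "h \<in> tangent_space A p" "k \<in> tangent_space A p" for h k
    using iso p that by (simp add: C1_isometry_def)
  have right: "\<Gamma> (\<Delta> q) = q" if "q \<in> topspace M" for q
    using bij that by (simp add: \<Delta>_def bij_betw_def f_inv_into_f)
  have \<Gamma>p: "\<Gamma> p \<in> topspace M" using bij p by (rule bij_betwE[rule_format])
  have left: "\<Delta> (\<Gamma> p) = p" using bij p by (simp add: \<Delta>_def bij_betw_def)
  have v: "gradient A g E p \<in> tangent_space A p" by (rule gradient_tangent[OF p])
  show ?thesis
  proof (rule gradient_eqI[OF \<Gamma>p tangent_map_in_tangent_space[OF \<Gamma> p v]])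
    fix h assume h: "h \<in> tangent_space A (\<Gamma> p)"
    define k where "k = tangent_map A \<Delta> (\<Gamma> p) h"
    have k: "k \<in> tangent_space A p"
      using tangent_map_in_tangent_space[OF \<Delta> \<Gamma>p h] by (simp add: k_def left)
    have hk: "h = tangent_map A \<Gamma> p k"
      using tangent_map_right_inverse[OF \<Gamma> \<Delta> right \<Gamma>p h] by (simp add: k_def left)
    have "differential A E (\<Gamma> p) h = differential A E p k"
      unfolding hk by (rule differential_invariant[OF \<Gamma> inv p k])
    also have "\<dots> = g p (gradient A g E p) k" by (rule gradient_metric[OF p k])
    also have "\<dots> = g (\<Gamma> p) (tangent_map A \<Gamma> p (gradient A g E p)) h"
      unfolding hk by (rule isometry[OF v k, symmetric])
    finally show "differential A E (\<Gamma> p) h = g (\<Gamma> p) (tangent_map A \<Gamma> p (gradient A g E p)) h" .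
  qed
qed

text \<open>By the chain rule the velocity of the image curve is the image of the negative gradient, which by
  \<open>gradient_equivariant\<close> is the negative gradient at the image point.\<close>

lemma isometry_maps_integral_curves:
  assumes iso: "C1_isometry M A g \<Gamma>" and inv: "\<And>p. p \<in> topspace M \<Longrightarrow> E (\<Gamma> p) = E p"
    and \<xi>: "flow.integral_curve I \<xi>"
  shows "flow.integral_curve I (\<lambda>t. \<Gamma> (\<xi> t))"
  unfolding flow.integral_curve_def
proof (intro conjI ballI impI)
  have \<Gamma>: "C1_map M A \<Gamma>" using iso by (simp add: C1_isometry_def C1_diffeomorphism_def)
  have cont: "continuous_map (top_of_set I) M \<xi>" by (rule flow.integral_curve_continuous[OF \<xi>])
  from continuous_map_compose[OF cont C1_map_continuous[OF \<Gamma>]]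
  show "continuous_map (top_of_set I) M (\<lambda>t. \<Gamma> (\<xi> t))" by (simp add: o_def)
  fix t d assume t: "t \<in> I" and d: "d \<in> A" "\<Gamma> (\<xi> t) \<in> chart_dom d"
  have p: "\<xi> t \<in> topspace M" by (rule flow.integral_curve_topspace[OF \<xi> t])
  obtain c where c: "c \<in> A" "\<xi> t \<in> chart_dom c" using chart_exists[OF p] by blast
  obtain a where a: "((chart_map d \<circ> \<Gamma> \<circ> chart_inv c) has_derivative a) (at (chart_map c (\<xi> t)))"
    by (rule C1_map_chart[OF \<Gamma> c(1) d(1) c(2) d(2)])
  have lin: "linear a" by (rule has_derivative_linear[OF a])
  have "((chart_map d \<circ> \<Gamma> \<circ> \<xi>) has_vector_derivative a (negative_gradient (\<xi> t) c)) (at t within I)"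
    by (rule curve_derivative[OF cont t c flow.integral_curve_derivative[OF \<xi> t c] a])
  moreover have "a (negative_gradient (\<xi> t) c) = negative_gradient (\<Gamma> (\<xi> t)) d"
    using tangent_map_eq[where f = \<Gamma>, OF c gradient_tangent[OF p] d a] gradient_equivariant[OF iso inv p]
    by (simp add: negative_gradient_def linear_neg[OF lin])
  ultimately show "((chart_map d \<circ> (\<lambda>t. \<Gamma> (\<xi> t))) has_vector_derivative negative_gradient (\<Gamma> (\<xi> t)) d) (at t within I)"
    by (simp add: o_def)
qed

end

section \<open>Symmetric critical points\<close>

theorem proposition2p5:
  fixes M :: "'a topology"
    and A :: "('a, 'h::{real_inner, complete_space}) chart set"
    and g :: "('a, 'h) metric_tensor"
    and G :: "('a \<Rightarrow> 'a) set"
    and E :: "'a \<Rightarrow> real"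
  assumes "riemannian_manifold_C2 M A g"
    and "group_of_C1_isometries M A g G"
    and "C11_loc_function A E"
    and "\<forall>\<Gamma>\<in>G. \<forall>p\<in>topspace M. E (\<Gamma> p) = E p"
    and "Palais_Smale_condition M A g E"
    and "bdd_below (E ` topspace M)"
    and "\<forall>x. path_Cauchy M A g x \<and> bounded (range (\<lambda>k. E (x k))) \<longrightarrow>
           (\<exists>y. limitin M x y sequentially)"
  shows "(\<forall>x. symmetric_point M G x \<longrightarrow>
           (\<exists>\<xi>. gradient_flow_solution M A g E x \<xi> \<and>
                (\<forall>\<eta>. gradient_flow_solution M A g E x \<eta> \<longrightarrow> (\<forall>t\<ge>0. \<eta> t = \<xi> t)) \<and>
                (\<forall>\<Gamma>\<in>G. \<forall>t\<ge>0. \<Gamma> (\<xi> t) = \<xi> t) \<and>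
                (\<exists>y. subconverges M \<xi> y \<and> symmetric_point M G y \<and> critical_point M A E y)))
       \<and> (\<forall>K\<in>connected_components_of M. (\<exists>x\<in>K. symmetric_point M G x) \<longrightarrow>
           (\<exists>y\<in>K. symmetric_point M G y \<and> critical_point M A E y))"
proof -
  interpret riemannian_function M A g E
    using assms(1,3) by unfold_locales (simp_all add: riemannian_manifold_C2_def)
  have iso: "C1_isometry M A g \<Gamma>" and inv: "\<And>p. p \<in> topspace M \<Longrightarrow> E (\<Gamma> p) = E p" if "\<Gamma> \<in> G" for \<Gamma>
    using assms(2,4) that by (simp_all add: group_of_C1_isometries_def)
  have complete: "\<exists>y. limitin M x y sequentially"
    if "path_Cauchy M A g x" "bounded (range (\<lambda>k. E (x k)))" for x
    using assms(7) that by blast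
  have main: "\<exists>\<xi>. flow.integral_curve {0..} \<xi> \<and> \<xi> 0 = x \<and> (\<forall>\<Gamma>\<in>G. \<forall>t\<ge>0. \<Gamma> (\<xi> t) = \<xi> t) \<and>
      (\<exists>y. subconverges M \<xi> y \<and> symmetric_point M G y \<and> critical_point M A E y)"
    if x: "symmetric_point M G x" for x
  proof -
    have top: "x \<in> topspace M" and fix_x: "\<And>\<Gamma>. \<Gamma> \<in> G \<Longrightarrow> \<Gamma> x = x"
      using x by (simp_all add: symmetric_point_def)
    obtain \<xi> where \<xi>: "flow.integral_curve {0..} \<xi>" "\<xi> 0 = x"
      by (rule flow.integral_curve_global_existence[OF top])
        (rule integral_curve_limit_at_finite_time[OF assms(6) complete], assumption+)
    have sym: "\<Gamma> (\<xi> t) = \<xi> t" if \<Gamma>: "\<Gamma> \<in> G" and t: "t \<ge> 0" for \<Gamma> t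
      by (rule gradient_flow_unique[OF isometry_maps_integral_curves[OF iso[OF \<Gamma>] inv[OF \<Gamma>] \<xi>(1)] \<xi>(1) _ t])
        (simp_all add: \<xi>(2) fix_x \<Gamma>)
    obtain y where y: "subconverges M \<xi> y" "critical_point M A E y"
      by (rule gradient_flow_subconverges[OF assms(6,5) \<xi>(1)])
    obtain s :: "nat \<Rightarrow> real" where s: "\<And>k. 0 \<le> s k" "limitin M (\<lambda>k. \<xi> (s k)) y sequentially"
      using y(1) unfolding subconverges_def by blast
    have "\<Gamma> y = y" if \<Gamma>: "\<Gamma> \<in> G" for \<Gamma>
    proof -
      have "continuous_map M M \<Gamma>"
        using iso[OF \<Gamma>] by (simp add: C1_isometry_def C1_diffeomorphism_def C1_map_def)
      from continuous_map_limit[OF this s(2)]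
      have "limitin M (\<lambda>k. \<xi> (s k)) (\<Gamma> y) sequentially" by (simp add: o_def sym[OF \<Gamma> s(1)])
      then show ?thesis by (rule limitin_Hausdorff_unique[OF _ s(2) trivial_limit_sequentially Hausdorff])
    qed
    then have "symmetric_point M G y"
      using limitin_topspace[OF s(2)] by (simp add: symmetric_point_def)
    then show ?thesis using \<xi> sym y by blast
  qed
  show ?thesis
  proof (intro conjI allI impI ballI)
    fix x assume "symmetric_point M G x"
    from main[OF this] obtain \<xi> where \<xi>: "flow.integral_curve {0..} \<xi>" "\<xi> 0 = x"
      "\<forall>\<Gamma>\<in>G. \<forall>t\<ge>0. \<Gamma> (\<xi> t) = \<xi> t"
      "\<exists>y. subconverges M \<xi> y \<and> symmetric_point M G y \<and> critical_point M A E y" by blast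
    show "\<exists>\<xi>. gradient_flow_solution M A g E x \<xi> \<and>
        (\<forall>\<eta>. gradient_flow_solution M A g E x \<eta> \<longrightarrow> (\<forall>t\<ge>0. \<eta> t = \<xi> t)) \<and>
        (\<forall>\<Gamma>\<in>G. \<forall>t\<ge>0. \<Gamma> (\<xi> t) = \<xi> t) \<and>
        (\<exists>y. subconverges M \<xi> y \<and> symmetric_point M G y \<and> critical_point M A E y)"
    proof (intro exI[of _ \<xi>] conjI allI impI)
      show "gradient_flow_solution M A g E x \<xi>" using \<xi> by (simp add: gradient_flow_solution_iff)
      fix \<eta> and t :: real assume \<eta>: "gradient_flow_solution M A g E x \<eta>" and t: "t \<ge> 0"
      show "\<eta> t = \<xi> t"
        using \<eta> \<xi>(2) by (intro gradient_flow_unique[OF _ \<xi>(1) _ t]) (simp_all add: gradient_flow_solution_iff)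
    qed (use \<xi> in blast)+
  next
    fix K assume K: "K \<in> connected_components_of M" and "\<exists>x\<in>K. symmetric_point M G x"
    then obtain x where x: "x \<in> K" "symmetric_point M G x" by blast
    from main[OF x(2)] obtain \<xi> y where \<xi>: "flow.integral_curve {0..} \<xi>" "\<xi> 0 = x"
      and y: "subconverges M \<xi> y" "symmetric_point M G y" "critical_point M A E y" by blast
    obtain s :: "nat \<Rightarrow> real" where s: "\<And>k. 0 \<le> s k" "limitin M (\<lambda>k. \<xi> (s k)) y sequentially"
      using y(1) unfolding subconverges_def by blast
    obtain a where a: "K = connected_component_of_set M a"
      using K unfolding connected_components_of_def by blast
    then have "connected_component_of M a x" using x(1) by simp
    then have "connected_component_of M a = connected_component_of M x"
      using connected_component_of_equiv[of M a x] by simp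
    then have Kx: "K = connected_component_of_set M x" by (simp only: a)
    have "\<xi> (s k) \<in> K" for k
      using flow.integral_curve_connected[OF \<xi>(1) connected_Ici, of 0 "s k"] s(1) \<xi>(2) by (simp add: Kx)
    then have "y \<in> K"
      by (intro limitin_closedin[OF s(2) closedin_connected_components_of[OF K]]) simp_all
    then show "\<exists>y\<in>K. symmetric_point M G y \<and> critical_point M A E y" using y by blast
  qed
qed

end
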